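(* Let $(u_k)_{k\ge1}$ be an entropy-balanced random process (with $h(\mathbf u_n)$ finite), and let $G$ be a causal LTI filter with transfer function $G(z)=\sum_{k=0}^{\eta}g_kz^{-k}$ (impulse response of length $\eta+1$, not identically zero). For each $n$ let $\mathbf y_{n+\eta}:=\breve{\mathbf G}_n\mathbf u_n\in\mathbb R^{n+\eta}$ be the entire output of $G$ (zero initial state) to the input $u_1,\dots,u_n$, where $\breve{\mathbf G}_n\in\mathbb R^{(n+\eta)\times n}$ has entries $[\breve{\mathbf G}_n]_{i,j}=g_{i-j}$ for $i\ge j$ (with $g_k=0$ for $k>\eta$) and $0$ for $i<j$. Then $$\lim_{n\to\infty}\frac1n\big(\breve h(\mathbf y_{n+\eta})-\breve h(\mathbf u_n)\big)=\frac1{2\pi}\int_{-\pi}^{\pi}\log|G(e^{j\omega})|\,d\omega.$$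
   Context: Notation: $\mathbf v_n:=(v_1,\dots,v_n)^T$; $h$ is differential entropy. Entropy balanced: a process $(v_k)$ is entropy balanced if for every $\nu\in\mathbb N$ and every sequence $(\Phi_n)_{n>\nu}$, $\Phi_n\in\mathbb R^{(n-\nu)\times n}$ with orthonormal rows, $\lim_{n\to\infty}\frac1n(h(\Phi_n\mathbf v_n)-h(\mathbf v_n))=0$. Effective differential entropy: if a random vector $\mathbf y\in\mathbb R^\ell$ can be written as $\mathbf y=\mathbf S\mathbf u$ with $\mathbf u\in\mathbb R^n$, $n\le\ell$, and $\mathbf S\in\mathbb R^{\ell\times n}$ of full column rank, with (thin) SVD $\mathbf S=\mathbf A^T\mathbf T\mathbf C$ where $\mathbf A\in\mathbb R^{n\times\ell}$ has orthonormal rows, $\mathbf T\in\mathbb R^{n\times n}$ is diagonal and $\mathbf C\in\mathbb R^{n\times n}$ is orthogonal, then $\breve h(\mathbf y):=h(\mathbf A\mathbf y)$. (In particular $\breve h(\mathbf u_n)=h(\mathbf u_n)$.) *)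

theory Defs
  imports "HOL-Probability.Probability"
begin

text \<open>Euclidean space R^n is modelled as extensional functions nat => real supported on
  the index set {..<n}, carrying the product of Lebesgue-Borel measures.
  Index i (0-based) corresponds to the paper's coordinate i+1.\<close>

definition lborelN :: "nat \<Rightarrow> (nat \<Rightarrow> real) measure" where
  "lborelN n = PiM {..<n} (\<lambda>_. lborel)"

definition diff_entropy :: "'a measure \<Rightarrow> nat \<Rightarrow> ('a \<Rightarrow> nat \<Rightarrow> real) \<Rightarrow> real" where
  "diff_entropy M n X = prob_space.entropy M (exp 1) (lborelN n) X"

definition finite_diff_entropy :: "'a measure \<Rightarrow> nat \<Rightarrow> ('a \<Rightarrow> nat \<Rightarrow> real) \<Rightarrow> bool" where
  "finite_diff_entropy M n X \<longleftrightarrow>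
     (\<exists>f. distributed M (lborelN n) X f \<and>
          integrable (lborelN n) (\<lambda>x. f x * ln (f x)) \<and>
          (\<forall>x\<in>space (lborelN n). 0 \<le> f x))"

definition proc_vec :: "nat \<Rightarrow> (nat \<Rightarrow> 'a \<Rightarrow> real) \<Rightarrow> 'a \<Rightarrow> nat \<Rightarrow> real" where
  "proc_vec n v = (\<lambda>\<omega>. restrict (\<lambda>i. v (Suc i) \<omega>) {..<n})"

text \<open>Matrices of size m x n are functions nat => nat => real; only entries with
  i < m, j < n are relevant.\<close>

definition mat_vec :: "nat \<Rightarrow> nat \<Rightarrow> (nat \<Rightarrow> nat \<Rightarrow> real) \<Rightarrow> (nat \<Rightarrow> real) \<Rightarrow> nat \<Rightarrow> real" where
  "mat_vec m n A x = restrict (\<lambda>i. \<Sum>j<n. A i j * x j) {..<m}"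

definition orthonormal_rows :: "nat \<Rightarrow> nat \<Rightarrow> (nat \<Rightarrow> nat \<Rightarrow> real) \<Rightarrow> bool" where
  "orthonormal_rows m n A \<longleftrightarrow>
     (\<forall>i<m. \<forall>k<m. (\<Sum>j<n. A i j * A k j) = (if i = k then 1 else 0))"

definition entropy_balanced :: "'a measure \<Rightarrow> (nat \<Rightarrow> 'a \<Rightarrow> real) \<Rightarrow> bool" where
  "entropy_balanced M v \<longleftrightarrow>
     (\<forall>\<nu>::nat. \<forall>\<Phi> :: nat \<Rightarrow> nat \<Rightarrow> nat \<Rightarrow> real.
        (\<forall>n>\<nu>. orthonormal_rows (n - \<nu>) n (\<Phi> n)) \<longrightarrow>
        (\<lambda>n. (diff_entropy M (n - \<nu>) (\<lambda>\<omega>. mat_vec (n - \<nu>) n (\<Phi> n) (proc_vec n v \<omega>))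
               - diff_entropy M n (proc_vec n v)) / real n) \<longlonglongrightarrow> 0)"

definition transpose_mat :: "(nat \<Rightarrow> nat \<Rightarrow> real) \<Rightarrow> nat \<Rightarrow> nat \<Rightarrow> real" where
  "transpose_mat A = (\<lambda>i j. A j i)"

definition mat_mult :: "nat \<Rightarrow> (nat \<Rightarrow> nat \<Rightarrow> real) \<Rightarrow> (nat \<Rightarrow> nat \<Rightarrow> real) \<Rightarrow> nat \<Rightarrow> nat \<Rightarrow> real" where
  "mat_mult k A B = (\<lambda>i j. \<Sum>l<k. A i l * B l j)"

definition thin_svd :: "nat \<Rightarrow> nat \<Rightarrow> (nat \<Rightarrow> nat \<Rightarrow> real) \<Rightarrow> (nat \<Rightarrow> nat \<Rightarrow> real)
    \<Rightarrow> (nat \<Rightarrow> nat \<Rightarrow> real) \<Rightarrow> (nat \<Rightarrow> nat \<Rightarrow> real) \<Rightarrow> bool" where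
  "thin_svd l n S A T C \<longleftrightarrow>
     orthonormal_rows n l A \<and>
     (\<forall>i<n. \<forall>j<n. i \<noteq> j \<longrightarrow> T i j = 0) \<and>
     orthonormal_rows n n C \<and>
     (\<forall>i<l. \<forall>j<n. S i j = mat_mult n (mat_mult n (transpose_mat A) T) C i j)"

definition full_column_rank :: "nat \<Rightarrow> nat \<Rightarrow> (nat \<Rightarrow> nat \<Rightarrow> real) \<Rightarrow> bool" where
  "full_column_rank l n S \<longleftrightarrow>
     (\<forall>x::nat \<Rightarrow> real. (\<forall>i<l. (\<Sum>j<n. S i j * x j) = 0) \<longrightarrow> (\<forall>j<n. x j = 0))"

text \<open>Effective differential entropy of y = S u (S is l x n of full column rank, n <= l):
  h(A y), where A is the left factor of a thin SVD of S.\<close>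

definition eff_entropy :: "'a measure \<Rightarrow> nat \<Rightarrow> nat \<Rightarrow> (nat \<Rightarrow> nat \<Rightarrow> real)
    \<Rightarrow> ('a \<Rightarrow> nat \<Rightarrow> real) \<Rightarrow> real" where
  "eff_entropy M l n S y =
     (let A = (SOME A. \<exists>T C. thin_svd l n S A T C)
      in diff_entropy M n (\<lambda>\<omega>. mat_vec n l A (y \<omega>)))"

definition conv_mat :: "(nat \<Rightarrow> real) \<Rightarrow> nat \<Rightarrow> nat \<Rightarrow> nat \<Rightarrow> real" where
  "conv_mat g \<eta> = (\<lambda>i j. if j \<le> i \<and> i - j \<le> \<eta> then g (i - j) else 0)"

definition freq_resp :: "(nat \<Rightarrow> real) \<Rightarrow> nat \<Rightarrow> real \<Rightarrow> complex" where
  "freq_resp g \<eta> \<omega> = (\<Sum>k\<le>\<eta>. complex_of_real (g k) * cis (- (real k * \<omega>)))"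

end

theory Submission
  imports Defs
    "Jordan_Normal_Form.Char_Poly"
    "HOL-Computational_Algebra.Polynomial_FPS"
    "HOL-Complex_Analysis.Cauchy_Integral_Formula"
    "HOL-Real_Asymp.Real_Asymp"
begin

text \<open>Write \<open>S = A\<^sup>T T C\<close> for the thin singular value decomposition of the convolution matrix. Then
  \<open>A S u = T C u\<close>, so the entropy of the output exceeds that of \<open>u\<close> by \<open>ln |det T|\<close>, which is
  \<open>(ln D\<^sub>n) / 2\<close> for the Gram determinant \<open>D\<^sub>n = det (S\<^sup>T S)\<close>. The claim is thus Szego's limit theorem for
  the Toeplitz matrix \<open>S\<^sup>T S\<close> with symbol \<open>|G|\<^sup>2\<close>.

  The Gram matrix does not change when the roots of \<open>G\<close>, as a polynomial in \<open>1 / z\<close>, inside the unit disc are reflected at the unit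
  circle. For the reflected polynomial \<open>Q\<close>, with \<open>|Q 0| = c\<close>, the power series \<open>1 / Q\<close> has polynomially
  bounded coefficients; multiplying by its Toeplitz matrix \<open>N\<close>, where \<open>|det N| = c\<^sup>-\<^sup>n\<close>, turns the columns
  of \<open>S\<close> into an identity block on top of a block \<open>K\<close> with a fixed number of rows. Hence
  \<open>D\<^sub>n = c\<^sup>2\<^sup>n det (1 + K K\<^sup>*)\<close>, and the last factor lies between 1 and a polynomial in \<open>n\<close>. Jensen's
  formula identifies \<open>ln c\<close> with the mean of \<open>ln |G|\<close> over the unit circle.\<close>

section \<open>Lebesgue measure and entropy under linear maps\<close>

lemma sets_lborelN: "sets (lborelN n) = sets (PiM {..<n} (\<lambda>_. borel))"
  unfolding lborelN_def by (intro sets_PiM_cong) auto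

lemma space_lborelN: "space (lborelN n) = {..<n} \<rightarrow>\<^sub>E UNIV"
  by (simp add: lborelN_def space_PiM)

lemma sigma_finite_lborelN: "sigma_finite_measure (lborelN n)"
proof -
  interpret product_sigma_finite "\<lambda>_::nat. lborel :: real measure" ..
  show ?thesis unfolding lborelN_def by (rule sigma_finite) simp
qed

lemma emeasure_lborelN_box:
  assumes "\<And>i. i < n \<Longrightarrow> A i \<in> sets borel"
  shows "emeasure (lborelN n) (Pi\<^sub>E {..<n} A) = (\<Prod>i<n. emeasure lborel (A i))"
proof -
  interpret product_sigma_finite "\<lambda>_::nat. lborel :: real measure" ..
  show ?thesis unfolding lborelN_def using assms by (subst emeasure_PiM) auto
qed

lemma measurable_lborelN_component:
  "i < n \<Longrightarrow> (\<lambda>x. x i) \<in> borel_measurable (lborelN n)"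
  by (simp add: measurable_cong_sets[OF sets_lborelN refl] measurable_component_singleton)

lemma measurable_lborelN_restrict:
  assumes "\<And>i. i < n \<Longrightarrow> (\<lambda>p. f p i) \<in> borel_measurable N"
  shows "(\<lambda>p. restrict (f p) {..<n}) \<in> N \<rightarrow>\<^sub>M lborelN n"
proof -
  have "(\<lambda>p. restrict (f p) {..<n}) \<in> N \<rightarrow>\<^sub>M PiM {..<n} (\<lambda>_. borel)"
    using assms by (intro measurable_restrict) auto
  then show ?thesis by (simp add: measurable_cong_sets[OF refl sets_lborelN])
qed

lemma measurable_mat_vec [measurable]: "mat_vec m n A \<in> lborelN n \<rightarrow>\<^sub>M lborelN m"
  unfolding mat_vec_def[abs_def]
  by (intro measurable_lborelN_restrict borel_measurable_sum borel_measurable_times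
      borel_measurable_const measurable_lborelN_component) simp

text \<open>Sigma-finite product measures are determined by boxes. On a box the map acts
  coordinatewise, so the claim factors into the one-dimensional \<open>lborel_real_affine\<close>,
  whose inverse-free form is kept here.\<close>

lemma distr_lborelN_affine:
  assumes t: "\<And>i. i < n \<Longrightarrow> t i \<noteq> 0"
  shows "lborelN n = density (distr (lborelN n) (lborelN n) (\<lambda>x. restrict (\<lambda>i. a i + t i * x i) {..<n}))
           (\<lambda>_. ennreal (\<Prod>i<n. \<bar>t i\<bar>))" (is "_ = density (distr _ _ ?T) _")
proof -
  interpret product_sigma_finite "\<lambda>_::nat. lborel :: real measure" ..
  have T: "?T \<in> lborelN n \<rightarrow>\<^sub>M lborelN n"
    by (intro measurable_lborelN_restrict borel_measurable_add borel_measurable_times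
        borel_measurable_const measurable_lborelN_component) simp
  have "density (distr (lborelN n) (lborelN n) ?T) (\<lambda>_. ennreal (\<Prod>i<n. \<bar>t i\<bar>)) = PiM {..<n} (\<lambda>_. lborel)"
  proof (rule PiM_eqI)
    show "sets (density (distr (lborelN n) (lborelN n) ?T) (\<lambda>_. ennreal (\<Prod>i<n. \<bar>t i\<bar>))) = sets (PiM {..<n} (\<lambda>_. lborel))"
      by (simp add: lborelN_def)
  next
    fix A :: "nat \<Rightarrow> real set" assume A: "\<And>i. i \<in> {..<n} \<Longrightarrow> A i \<in> sets lborel"
    have A': "Pi\<^sub>E {..<n} A \<in> sets (lborelN n)"
      unfolding lborelN_def using A by (intro sets_PiM_I_finite) auto
    have pre: "?T -` Pi\<^sub>E {..<n} A \<inter> space (lborelN n) = Pi\<^sub>E {..<n} (\<lambda>i. {x. a i + t i * x \<in> A i})"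
    proof (rule Set.set_eqI)
      fix x
      have "?T x \<in> Pi\<^sub>E {..<n} A \<longleftrightarrow> (\<forall>i<n. a i + t i * x i \<in> A i)"
        by (simp add: PiE_iff Ball_def)
      then show "x \<in> ?T -` Pi\<^sub>E {..<n} A \<inter> space (lborelN n) \<longleftrightarrow> x \<in> Pi\<^sub>E {..<n} (\<lambda>i. {x. a i + t i * x \<in> A i})"
        by (simp add: space_lborelN PiE_iff Ball_def)
    qed
    have m: "{x. a i + t i * x \<in> A i} \<in> sets borel" if "i < n" for i
    proof -
      have "(\<lambda>x. a i + t i * x) -` A i \<inter> space borel \<in> sets borel"
        using A that by (intro measurable_sets[where A=borel]) auto
      then show ?thesis by (simp add: vimage_def)
    qed
    have one: "ennreal \<bar>t i\<bar> * emeasure lborel {x. a i + t i * x \<in> A i} = emeasure lborel (A i)" if "i < n" for i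
    proof -
      have "emeasure lborel (A i) = emeasure (density (distr lborel borel (\<lambda>x. a i + t i * x)) (\<lambda>_. ennreal \<bar>t i\<bar>)) (A i)"
        using lborel_real_affine[OF t[OF that], of "a i"] by simp
      also have "\<dots> = ennreal \<bar>t i\<bar> * emeasure (distr lborel borel (\<lambda>x. a i + t i * x)) (A i)"
        using A that by (subst emeasure_density_const) auto
      also have "emeasure (distr lborel borel (\<lambda>x. a i + t i * x)) (A i) = emeasure lborel {x. a i + t i * x \<in> A i}"
        using A that by (subst emeasure_distr) (auto simp: vimage_def)
      finally show ?thesis by simp
    qed
    have "emeasure (density (distr (lborelN n) (lborelN n) ?T) (\<lambda>_. ennreal (\<Prod>i<n. \<bar>t i\<bar>))) (Pi\<^sub>E {..<n} A)
      = ennreal (\<Prod>i<n. \<bar>t i\<bar>) * emeasure (lborelN n) (Pi\<^sub>E {..<n} (\<lambda>i. {x. a i + t i * x \<in> A i}))"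
      using A' T by (simp add: emeasure_density_const emeasure_distr pre)
    also have "\<dots> = (\<Prod>i<n. ennreal \<bar>t i\<bar>) * (\<Prod>i<n. emeasure lborel {x. a i + t i * x \<in> A i})"
      using m by (subst emeasure_lborelN_box) (auto simp: prod_ennreal)
    also have "\<dots> = (\<Prod>i<n. emeasure lborel (A i))"
      using one by (simp add: prod.distrib[symmetric])
    finally show "emeasure (density (distr (lborelN n) (lborelN n) ?T) (\<lambda>_. ennreal (\<Prod>i<n. \<bar>t i\<bar>))) (Pi\<^sub>E {..<n} A)
        = (\<Prod>i<n. emeasure lborel (A i))" .
  qed simp
  then show ?thesis by (simp add: lborelN_def)
qed

text \<open>Since |t i| = 1 the density of the affine change of variables is 1. Used for
  translations (t = 1) and for point reflections (t = -1) in the Fubini argument for orthogonal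
  maps.\<close>

lemma nn_integral_lborelN_affine:
  assumes f: "f \<in> borel_measurable (lborelN n)" and t: "\<And>i. i < n \<Longrightarrow> \<bar>t i\<bar> = 1"
  shows "(\<integral>\<^sup>+x. f (restrict (\<lambda>i. a i + t i * x i) {..<n}) \<partial>lborelN n) = (\<integral>\<^sup>+x. f x \<partial>lborelN n)"
proof -
  let ?T = "\<lambda>x. restrict (\<lambda>i. a i + t i * x i) {..<n}"
  have T: "?T \<in> lborelN n \<rightarrow>\<^sub>M lborelN n"
    by (intro measurable_lborelN_restrict borel_measurable_add borel_measurable_times
        borel_measurable_const measurable_lborelN_component) simp
  have "t i \<noteq> 0" if "i < n" for i using t[OF that] by auto
  from distr_lborelN_affine[of n t a, OF this]
  have eq: "lborelN n = distr (lborelN n) (lborelN n) ?T"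
    using t by (simp add: density_1)
  have "(\<integral>\<^sup>+x. f x \<partial>lborelN n) = (\<integral>\<^sup>+x. f x \<partial>distr (lborelN n) (lborelN n) ?T)"
    using eq by simp
  also have "\<dots> = (\<integral>\<^sup>+x. f (?T x) \<partial>lborelN n)"
    using f T by (subst nn_integral_distr) auto
  finally show ?thesis by simp
qed

section \<open>Square matrices with orthonormal rows\<close>

lemma mat_vec_mat_vec:
  "mat_vec m n A (mat_vec n k B x) = mat_vec m k (mat_mult n A B) x"
proof -
  have "(\<Sum>j<n. A i j * (\<Sum>l<k. B j l * x l)) = (\<Sum>l<k. (\<Sum>j<n. A i j * B j l) * x l)" for i
    by (simp add: sum_distrib_left sum_distrib_right mult.assoc) (rule sum.swap)
  then show ?thesis by (auto simp: mat_vec_def mat_mult_def intro!: restrict_ext)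
qed

lemma mat_vec_id:
  assumes "x \<in> {..<n} \<rightarrow>\<^sub>E UNIV" "\<And>i j. i < n \<Longrightarrow> j < n \<Longrightarrow> A i j = (if i = j then 1 else 0)"
  shows "mat_vec n n A x = x"
proof
  fix i show "mat_vec n n A x i = x i"
  proof (cases "i < n")
    case True
    then have "(\<Sum>j<n. A i j * x j) = (\<Sum>j<n. if i = j then x j else 0)"
      using assms(2) by (intro sum.cong) auto
    with True show ?thesis by (simp add: mat_vec_def)
  next
    case False
    with assms(1) show ?thesis by (auto simp: mat_vec_def PiE_iff extensional_def)
  qed
qed

text \<open>A right inverse of a square matrix is also a left inverse, so orthonormal rows force
  orthonormal columns.\<close>

lemma orthonormal_rows_transpose:
  assumes "orthonormal_rows n n C"
  shows "orthonormal_rows n n (Defs.transpose_mat C)"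
proof -
  let ?A = "mat n n (\<lambda>(i,j). C i j)" and ?B = "mat n n (\<lambda>(i,j). C j i)"
  have "?A * ?B = 1\<^sub>m n"
    using assms by (intro eq_matI) (auto simp: orthonormal_rows_def scalar_prod_def lessThan_atLeast0)
  then have *: "?B * ?A = 1\<^sub>m n"
    by (intro mat_mult_left_right_inverse[of ?A n ?B]) auto
  have "(\<Sum>j<n. C j i * C j k) = (if i = k then 1 else 0)" if "i < n" "k < n" for i k
    using arg_cong[OF *, of "\<lambda>M. M $$ (i,k)"] that
    by (auto simp: scalar_prod_def lessThan_atLeast0)
  then show ?thesis by (auto simp: orthonormal_rows_def Defs.transpose_mat_def)
qed

lemma orthonormal_inverse:
  assumes C: "orthonormal_rows n n C" and x: "x \<in> {..<n} \<rightarrow>\<^sub>E UNIV"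
  shows "mat_vec n n C (mat_vec n n (Defs.transpose_mat C) x) = x"
    and "mat_vec n n (Defs.transpose_mat C) (mat_vec n n C x) = x"
proof -
  show "mat_vec n n C (mat_vec n n (Defs.transpose_mat C) x) = x"
    using C x unfolding mat_vec_mat_vec
    by (intro mat_vec_id) (auto simp: mat_mult_def orthonormal_rows_def Defs.transpose_mat_def)
  show "mat_vec n n (Defs.transpose_mat C) (mat_vec n n C x) = x"
    using orthonormal_rows_transpose[OF C] x unfolding mat_vec_mat_vec
    by (intro mat_vec_id) (auto simp: mat_mult_def orthonormal_rows_def Defs.transpose_mat_def)
qed

text \<open>Expanding the squares leaves the inner products of the columns of C. The purpose is that
  the Euclidean unit ball is invariant.\<close>

lemma orthonormal_norm:
  assumes C: "orthonormal_rows n n C"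
  shows "(\<Sum>i<n. (mat_vec n n C x i)\<^sup>2) = (\<Sum>i<n. (x i)\<^sup>2)"
proof -
  have swap: "(\<Sum>i<n. \<Sum>j<n. \<Sum>k<n. f i j k) = (\<Sum>j<n. \<Sum>k<n. \<Sum>i<n. f i j k)" for f :: "nat \<Rightarrow> nat \<Rightarrow> nat \<Rightarrow> real"
    using sum.swap[of "\<lambda>i j. \<Sum>k<n. f i j k" "{..<n}" "{..<n}"]
    by (simp add: sum.swap[of "\<lambda>i k. f i _ k" "{..<n}" "{..<n}"])
  have "(\<Sum>i<n. (mat_vec n n C x i)\<^sup>2) = (\<Sum>i<n. \<Sum>j<n. \<Sum>k<n. C i j * x j * (C i k * x k))"
    by (simp add: mat_vec_def power2_eq_square sum_product)
  also have "\<dots> = (\<Sum>j<n. \<Sum>k<n. \<Sum>i<n. C i j * x j * (C i k * x k))"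
    by (rule swap)
  also have "\<dots> = (\<Sum>j<n. \<Sum>k<n. (\<Sum>i<n. C i j * C i k) * (x j * x k))"
    by (simp add: sum_distrib_right sum_distrib_left ac_simps)
  also have "\<dots> = (\<Sum>j<n. \<Sum>k<n. if j = k then x j * x k else 0)"
    using orthonormal_rows_transpose[OF C]
    by (intro sum.cong refl) (auto simp: orthonormal_rows_def Defs.transpose_mat_def)
  also have "\<dots> = (\<Sum>i<n. (x i)\<^sup>2)" by (simp add: power2_eq_square)
  finally show ?thesis .
qed

text \<open>With T x = C x, Fubini and the translation invariance of Lebesgue measure give
  vol(E) * vol(T^-1 F) = vol(T^-1 E) * vol(F) for all measurable E and F. Taking for F the unit ball,
  which T preserves, yields vol(E) = vol(T^-1 E).\<close>

lemma distr_lborelN_orthonormal: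
  assumes C: "orthonormal_rows n n C"
  shows "distr (lborelN n) (lborelN n) (mat_vec n n C) = lborelN n"
proof -
  let ?\<mu> = "lborelN n" and ?T = "mat_vec n n C" and ?U = "mat_vec n n (Defs.transpose_mat C)"
  interpret sigma_finite_measure ?\<mu> by (rule sigma_finite_lborelN)
  interpret P: pair_sigma_finite ?\<mu> ?\<mu> ..
  define add where "add x y = restrict (\<lambda>i. x i + y i) {..<n}" for x y :: "nat \<Rightarrow> real"
  define sub where "sub x y = restrict (\<lambda>i. x i - y i) {..<n}" for x y :: "nat \<Rightarrow> real"
  note comp = measurable_lborelN_component
  have T: "?T \<in> ?\<mu> \<rightarrow>\<^sub>M ?\<mu>" by (rule measurable_mat_vec)
  have Ts: "(\<lambda>p. ?T (snd p)) \<in> ?\<mu> \<Otimes>\<^sub>M ?\<mu> \<rightarrow>\<^sub>M ?\<mu>"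
    by (rule measurable_compose[OF measurable_snd T])
  have add1: "(\<lambda>y. add x (?T y)) \<in> ?\<mu> \<rightarrow>\<^sub>M ?\<mu>" for x
    unfolding add_def
    by (intro measurable_lborelN_restrict borel_measurable_add borel_measurable_const measurable_compose[OF T comp])
  have add2: "(\<lambda>p. add (fst p) (?T (snd p))) \<in> ?\<mu> \<Otimes>\<^sub>M ?\<mu> \<rightarrow>\<^sub>M ?\<mu>"
    unfolding add_def
    by (intro measurable_lborelN_restrict borel_measurable_add measurable_compose[OF measurable_fst comp] measurable_compose[OF Ts comp])
  have sub2: "(\<lambda>p. sub (?T (snd p)) (fst p)) \<in> ?\<mu> \<Otimes>\<^sub>M ?\<mu> \<rightarrow>\<^sub>M ?\<mu>"
    unfolding sub_def
    by (intro measurable_lborelN_restrict borel_measurable_diff measurable_compose[OF measurable_fst comp] measurable_compose[OF Ts comp])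
  have shift: "(\<integral>\<^sup>+x. f (add x a) \<partial>?\<mu>) = (\<integral>\<^sup>+x. f x \<partial>?\<mu>)" if "f \<in> borel_measurable ?\<mu>" for f a
    using nn_integral_lborelN_affine[OF that, of "\<lambda>_. 1" a] by (simp add: add_def add.commute)
  have shift': "(\<integral>\<^sup>+x. f (sub x a) \<partial>?\<mu>) = (\<integral>\<^sup>+x. f x \<partial>?\<mu>)" if "f \<in> borel_measurable ?\<mu>" for f a
    using nn_integral_lborelN_affine[OF that, of "\<lambda>_. 1" "\<lambda>i. - a i"] by (simp add: sub_def)
  have refl': "(\<integral>\<^sup>+x. f (sub a x) \<partial>?\<mu>) = (\<integral>\<^sup>+x. f x \<partial>?\<mu>)" if "f \<in> borel_measurable ?\<mu>" for f a
    using nn_integral_lborelN_affine[OF that, of "\<lambda>_. -1" a] by (simp add: sub_def)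
  have Tsub: "?T (sub y (?U x)) = sub (?T y) x" if "x \<in> space ?\<mu>" for x y
  proof -
    have "?T (sub y (?U x)) = sub (?T y) (?T (?U x))"
      by (auto simp: mat_vec_def sub_def right_diff_distrib sum_subtractf intro!: restrict_ext)
    with that show ?thesis using orthonormal_inverse(1)[OF C, of x] by (simp add: space_lborelN)
  qed
  have addsub: "add x (sub y x) = y" if "y \<in> space ?\<mu>" for x y
    using that by (auto simp: add_def sub_def space_lborelN fun_eq_iff PiE_iff extensional_def)
  have main: "emeasure ?\<mu> E * emeasure ?\<mu> (?T -` F \<inter> space ?\<mu>) = emeasure ?\<mu> (?T -` E \<inter> space ?\<mu>) * emeasure ?\<mu> F"
    if "E \<in> sets ?\<mu>" "F \<in> sets ?\<mu>" for E F
  proof -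
    note ind = borel_measurable_indicator[OF that(1)] borel_measurable_indicator[OF that(2)]
    have TE: "?T -` E \<inter> space ?\<mu> \<in> sets ?\<mu>" "?T -` F \<inter> space ?\<mu> \<in> sets ?\<mu>"
      using measurable_sets[OF T] that by auto
    have m1: "(\<lambda>y. indicator E (add x (?T y)) * indicator F (?T y) :: ennreal) \<in> borel_measurable ?\<mu>" for x
      by (intro borel_measurable_times_ennreal measurable_compose[OF add1 ind(1)] measurable_compose[OF T ind(2)])
    have m2: "(\<lambda>(x, y). indicator E (add x (?T y)) * indicator F (?T y) :: ennreal) \<in> borel_measurable (?\<mu> \<Otimes>\<^sub>M ?\<mu>)"
      unfolding case_prod_beta
      by (intro borel_measurable_times_ennreal measurable_compose[OF add2 ind(1)] measurable_compose[OF Ts ind(2)])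
    have m3: "(\<lambda>(x, y). indicator E (?T y) * indicator F (sub (?T y) x) :: ennreal) \<in> borel_measurable (?\<mu> \<Otimes>\<^sub>M ?\<mu>)"
      unfolding case_prod_beta
      by (intro borel_measurable_times_ennreal measurable_compose[OF sub2 ind(2)] measurable_compose[OF Ts ind(1)])
    have "emeasure ?\<mu> E * emeasure ?\<mu> (?T -` F \<inter> space ?\<mu>) =
        (\<integral>\<^sup>+y. emeasure ?\<mu> E * indicator (?T -` F \<inter> space ?\<mu>) y \<partial>?\<mu>)"
      using TE by (subst nn_integral_cmult) auto
    also have "\<dots> = (\<integral>\<^sup>+y. (\<integral>\<^sup>+x. indicator E x * indicator F (?T y) \<partial>?\<mu>) \<partial>?\<mu>)"
    proof (rule nn_integral_cong)
      fix y assume "y \<in> space ?\<mu>"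
      then have "indicator (?T -` F \<inter> space ?\<mu>) y = (indicator F (?T y) :: ennreal)"
        by (simp add: indicator_def)
      then show "emeasure ?\<mu> E * indicator (?T -` F \<inter> space ?\<mu>) y = (\<integral>\<^sup>+x. indicator E x * indicator F (?T y) \<partial>?\<mu>)"
        using that by (simp add: nn_integral_multc)
    qed
    also have "\<dots> = (\<integral>\<^sup>+y. (\<integral>\<^sup>+x. indicator E (add x (?T y)) * indicator F (?T y) \<partial>?\<mu>) \<partial>?\<mu>)"
    proof (rule nn_integral_cong)
      fix y
      show "(\<integral>\<^sup>+x. indicator E x * indicator F (?T y) \<partial>?\<mu>) = (\<integral>\<^sup>+x. indicator E (add x (?T y)) * indicator F (?T y) \<partial>?\<mu>)"
        using shift[of "\<lambda>x. indicator E x * indicator F (?T y)" "?T y"] that by simp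
    qed
    also have "\<dots> = (\<integral>\<^sup>+x. (\<integral>\<^sup>+y. indicator E (add x (?T y)) * indicator F (?T y) \<partial>?\<mu>) \<partial>?\<mu>)"
      by (rule P.Fubini'[OF m2])
    \<comment> \<open>For fixed x, translate y by \<open>?U x\<close>, where \<open>?U\<close>
      inverts \<open>?T\<close>. This replaces T y by T y - x, so the argument x + T y of E becomes
      T y. After Fubini, the reflection of x through T y makes F depend on x alone.\<close>
    also have "\<dots> = (\<integral>\<^sup>+x. (\<integral>\<^sup>+y. indicator E (add x (?T (sub y (?U x)))) * indicator F (?T (sub y (?U x))) \<partial>?\<mu>) \<partial>?\<mu>)"
      by (rule nn_integral_cong) (rule shift'[OF m1, symmetric])
    also have "\<dots> = (\<integral>\<^sup>+x. (\<integral>\<^sup>+y. indicator E (?T y) * indicator F (sub (?T y) x) \<partial>?\<mu>) \<partial>?\<mu>)"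
      by (intro nn_integral_cong) (simp only: Tsub addsub[OF measurable_space[OF T]])
    also have "\<dots> = (\<integral>\<^sup>+y. (\<integral>\<^sup>+x. indicator E (?T y) * indicator F (sub (?T y) x) \<partial>?\<mu>) \<partial>?\<mu>)"
      by (rule P.Fubini'[OF m3, symmetric])
    also have "\<dots> = (\<integral>\<^sup>+y. (\<integral>\<^sup>+x. indicator E (?T y) * indicator F x \<partial>?\<mu>) \<partial>?\<mu>)"
    proof (rule nn_integral_cong)
      fix y
      show "(\<integral>\<^sup>+x. indicator E (?T y) * indicator F (sub (?T y) x) \<partial>?\<mu>) = (\<integral>\<^sup>+x. indicator E (?T y) * indicator F x \<partial>?\<mu>)"
        using refl'[of "\<lambda>x. indicator E (?T y) * indicator F x" "?T y"] that by simp
    qed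
    also have "\<dots> = (\<integral>\<^sup>+y. indicator (?T -` E \<inter> space ?\<mu>) y * emeasure ?\<mu> F \<partial>?\<mu>)"
    proof (rule nn_integral_cong)
      fix y assume "y \<in> space ?\<mu>"
      then have "indicator (?T -` E \<inter> space ?\<mu>) y = (indicator E (?T y) :: ennreal)"
        by (simp add: indicator_def)
      then show "(\<integral>\<^sup>+x. indicator E (?T y) * indicator F x \<partial>?\<mu>) = indicator (?T -` E \<inter> space ?\<mu>) y * emeasure ?\<mu> F"
        using that by (simp add: nn_integral_cmult)
    qed
    also have "\<dots> = emeasure ?\<mu> (?T -` E \<inter> space ?\<mu>) * emeasure ?\<mu> F"
      using TE by (subst nn_integral_multc) auto
    finally show ?thesis .
  qed
  define F where "F = {x \<in> space ?\<mu>. (\<Sum>i<n. (x i)\<^sup>2) \<le> 1}"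
  have F: "F \<in> sets ?\<mu>"
    unfolding F_def by (intro borel_measurable_le borel_measurable_sum borel_measurable_power comp borel_measurable_const) auto
  have TF: "?T -` F \<inter> space ?\<mu> = F"
    using orthonormal_norm[OF C] measurable_space[OF measurable_mat_vec[of n n C]] by (auto simp: F_def)
  have Ffin: "emeasure ?\<mu> F \<noteq> \<infinity>"
  proof -
    have "F \<subseteq> Pi\<^sub>E {..<n} (\<lambda>_. {-1..1})"
    proof
      fix x assume x: "x \<in> F"
      have "x i \<in> {-1..1}" if "i < n" for i
      proof -
        have "(x i)\<^sup>2 \<le> (\<Sum>i<n. (x i)\<^sup>2)" using that by (intro member_le_sum) auto
        also have "\<dots> \<le> 1" using x by (simp add: F_def)
        finally show ?thesis by (auto simp: abs_square_le_1 abs_le_iff)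
      qed
      with x show "x \<in> Pi\<^sub>E {..<n} (\<lambda>_. {-1..1})" by (auto simp: F_def space_lborelN PiE_iff)
    qed
    then have "emeasure ?\<mu> F \<le> emeasure ?\<mu> (Pi\<^sub>E {..<n} (\<lambda>_. {-1..1}))"
      by (intro emeasure_mono) (auto simp: lborelN_def intro!: sets_PiM_I_finite)
    also have "\<dots> = ennreal (2 ^ n)"
      using ennreal_power[of 2 n] by (subst emeasure_lborelN_box) auto
    also have "\<dots> < \<infinity>" by (simp only: infinity_ennreal_def ennreal_less_top)
    finally show ?thesis by simp
  qed
  have Fpos: "emeasure ?\<mu> F \<noteq> 0"
  proof -
    \<comment> \<open>A cube of side \<open>?d\<close> fits into the ball: 0 <= x i <=
      \<open>?d\<close> <= 1 bounds each square by \<open>?d\<close>, and n times \<open>?d\<close>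
      is at most 1. The \<open>+ 1\<close> keeps the denominator nonzero for n = 0.\<close>
    let ?d = "1 / (real n + 1)"
    have "Pi\<^sub>E {..<n} (\<lambda>_. {0..?d}) \<subseteq> F"
    proof
      fix x assume x: "x \<in> Pi\<^sub>E {..<n} (\<lambda>_. {0..?d})"
      have "(\<Sum>i<n. (x i)\<^sup>2) \<le> (\<Sum>i<n. ?d)"
      proof (rule sum_mono)
        fix i assume "i \<in> {..<n}"
        with x have i: "0 \<le> x i" "x i \<le> ?d" by (auto simp: PiE_iff)
        have "?d \<le> 1" by simp
        with i(2) have "x i \<le> 1" by (rule order_trans)
        have "(x i)\<^sup>2 \<le> ?d * 1" unfolding power2_eq_square
          using i \<open>x i \<le> 1\<close> by (intro mult_mono) auto
        then show "(x i)\<^sup>2 \<le> ?d" by simp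
      qed
      also have "\<dots> \<le> 1" by (simp add: field_simps)
      finally show "x \<in> F" using x by (auto simp: F_def space_lborelN PiE_iff)
    qed
    then have "emeasure ?\<mu> (Pi\<^sub>E {..<n} (\<lambda>_. {0..?d})) \<le> emeasure ?\<mu> F"
      by (intro emeasure_mono F)
    moreover have "emeasure ?\<mu> (Pi\<^sub>E {..<n} (\<lambda>_. {0..?d})) = ennreal (?d ^ n)"
      by (subst emeasure_lborelN_box) (auto simp: ennreal_power)
    moreover have "ennreal (?d ^ n) > 0" by simp
    ultimately show ?thesis by auto
  qed
  show ?thesis
  proof (rule measure_eqI)
    fix E assume "E \<in> sets (distr ?\<mu> ?\<mu> ?T)"
    then have E: "E \<in> sets ?\<mu>" by simp
    from main[OF E F] TF
    have "emeasure ?\<mu> E * emeasure ?\<mu> F / emeasure ?\<mu> F = emeasure ?\<mu> (?T -` E \<inter> space ?\<mu>) * emeasure ?\<mu> F / emeasure ?\<mu> F"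
      by simp
    with Ffin Fpos have "emeasure ?\<mu> E = emeasure ?\<mu> (?T -` E \<inter> space ?\<mu>)"
      by (simp add: ennreal_mult_divide_eq)
    then show "emeasure (distr ?\<mu> ?\<mu> ?T) E = emeasure ?\<mu> E"
      using E T by (simp add: emeasure_distr)
  qed simp
qed

text \<open>B is an orthogonal map followed by the scaling diag(t). The first preserves Lebesgue
  measure and the second scales it by d = prod |t i|, so B X has density f(V y) / d with V inverse
  to B, and the entropy grows by ln d. Integrability of f ln f allows the resulting integral to be
  split.\<close>

lemma diff_entropy_mat_vec:
  assumes M: "prob_space M" and fin: "finite_diff_entropy M n X"
    and C: "orthonormal_rows n n C" and t: "\<And>i. i < n \<Longrightarrow> t i \<noteq> 0"
    and B: "\<And>i j. i < n \<Longrightarrow> j < n \<Longrightarrow> B i j = t i * C i j"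
  shows "diff_entropy M n (\<lambda>\<omega>. mat_vec n n B (X \<omega>)) = diff_entropy M n X + (\<Sum>i<n. ln \<bar>t i\<bar>)"
proof -
  interpret prob_space M by fact
  interpret information_space M "exp 1" by unfold_locales simp
  let ?\<mu> = "lborelN n" and ?T = "mat_vec n n B"
  \<comment> \<open>The summand 0 puts the scaling into the shape of
    \<open>distr_lborelN_affine\<close>.\<close>
  define D where "D x = restrict (\<lambda>i. 0 + t i * x i) {..<n}" for x :: "nat \<Rightarrow> real"
  define D' where "D' x = restrict (\<lambda>i. 0 + inverse (t i) * x i) {..<n}" for x :: "nat \<Rightarrow> real"
  define V where "V x = mat_vec n n (Defs.transpose_mat C) (D' x)" for x
  define d where "d = (\<Prod>i<n. \<bar>t i\<bar>)"
  have d: "d > 0" unfolding d_def using t by (intro prod_pos) auto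
  have ln_d: "ln d = (\<Sum>i<n. ln \<bar>t i\<bar>)" unfolding d_def using t by (subst ln_prod) auto
  have TD: "?T x = D (mat_vec n n C x)" for x
    using B by (auto simp: mat_vec_def D_def sum_distrib_left mult.assoc intro!: restrict_ext)
  have TD': "?T = (\<lambda>x. D (mat_vec n n C x))" by (rule ext) (rule TD)
  have mD: "D \<in> ?\<mu> \<rightarrow>\<^sub>M ?\<mu>" "D' \<in> ?\<mu> \<rightarrow>\<^sub>M ?\<mu>"
    unfolding D_def[abs_def] D'_def[abs_def]
    by (intro measurable_lborelN_restrict borel_measurable_add borel_measurable_times
        borel_measurable_const measurable_lborelN_component; simp)+
  have mV: "V \<in> ?\<mu> \<rightarrow>\<^sub>M ?\<mu>" unfolding V_def[abs_def]
    by (rule measurable_compose[OF mD(2) measurable_mat_vec])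
  have mT: "?T \<in> ?\<mu> \<rightarrow>\<^sub>M ?\<mu>" by (rule measurable_mat_vec)
  have VT: "V (?T x) = x" if "x \<in> space ?\<mu>" for x
  proof -
    have "D' (D (mat_vec n n C x)) = mat_vec n n C x"
      using t by (auto simp: D_def D'_def mat_vec_def intro!: restrict_ext)
    with that show ?thesis using orthonormal_inverse(2)[OF C, of x]
      by (simp add: V_def TD space_lborelN)
  qed
  have distrD: "?\<mu> = density (distr ?\<mu> ?\<mu> D) (\<lambda>_. ennreal d)"
    unfolding D_def[abs_def] d_def by (rule distr_lborelN_affine) (use t in auto)
  have "distr ?\<mu> ?\<mu> ?T = distr (distr ?\<mu> ?\<mu> (mat_vec n n C)) ?\<mu> D"
    by (subst distr_distr[OF mD(1) measurable_mat_vec]) (simp add: comp_def TD')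
  then have distrT: "?\<mu> = density (distr ?\<mu> ?\<mu> ?T) (\<lambda>_. ennreal d)"
    using distrD by (simp add: distr_lborelN_orthonormal[OF C])
  obtain f where f: "distributed M ?\<mu> X f" and int: "integrable ?\<mu> (\<lambda>x. f x * ln (f x))"
    and pos: "\<And>x. x \<in> space ?\<mu> \<Longrightarrow> 0 \<le> f x"
    using fin by (auto simp: finite_diff_entropy_def)
  note mf = distributed_real_measurable[OF pos f]
  have mX: "X \<in> M \<rightarrow>\<^sub>M ?\<mu>" using distributed_measurable[OF f] .
  define h where "h y = f (V y) / d" for y
  have mh: "h \<in> borel_measurable ?\<mu>" unfolding h_def[abs_def]
    by (intro borel_measurable_divide measurable_compose[OF mV mf] borel_measurable_const)
  have hpos: "0 \<le> h y" if "y \<in> space ?\<mu>" for y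
    using pos[OF measurable_space[OF mV that]] d by (simp add: h_def)
  have hT: "h (?T x) = f x / d" if "x \<in> space ?\<mu>" for x using VT[OF that] by (simp add: h_def)
  have dist: "distributed M ?\<mu> (\<lambda>\<omega>. ?T (X \<omega>)) h"
  proof -
    have "distr M ?\<mu> (\<lambda>\<omega>. ?T (X \<omega>)) = distr (distr M ?\<mu> X) ?\<mu> ?T"
      by (subst distr_distr[OF mT mX]) (simp add: comp_def)
    also have "\<dots> = distr (density ?\<mu> f) ?\<mu> ?T"
      using distributed_distr_eq_density[OF f] by simp
    also have "\<dots> = distr (density ?\<mu> (\<lambda>x. ennreal d * ennreal (h (?T x)))) ?\<mu> ?T"
    proof (rule arg_cong[where f="\<lambda>N. distr N ?\<mu> ?T"], rule density_cong)
      show "AE x in ?\<mu>. ennreal (f x) = ennreal d * ennreal (h (?T x))"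
        using d pos by (intro AE_I2) (simp add: hT ennreal_mult[symmetric])
    qed (use mf mh mT in auto)
    also have "\<dots> = density (distr ?\<mu> ?\<mu> ?T) (\<lambda>y. ennreal d * ennreal (h y))"
      using mh mT by (subst density_distr) auto
    also have "\<dots> = density (density (distr ?\<mu> ?\<mu> ?T) (\<lambda>_. ennreal d)) (\<lambda>y. ennreal (h y))"
      using mh by (subst density_density_eq) auto
    also have "\<dots> = density ?\<mu> (\<lambda>y. ennreal (h y))" using distrT by simp
    finally show ?thesis using mh measurable_compose[OF mX mT] by (simp add: distributed_def)
  qed
  have int1: "(\<integral>x. f x \<partial>?\<mu>) = 1" "integrable ?\<mu> f"
    using distributed_integral[OF f _ pos, of "\<lambda>_. 1"] distributed_integrable[OF f _ pos, of "\<lambda>_. 1"]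
    by (auto simp: prob_space)
  have "(\<integral>y. h y * ln (h y) \<partial>?\<mu>) = (\<integral>y. h y * ln (h y) \<partial>density (distr ?\<mu> ?\<mu> ?T) (\<lambda>_. ennreal d))"
    using distrT by simp
  also have "\<dots> = (\<integral>y. d * (h y * ln (h y)) \<partial>distr ?\<mu> ?\<mu> ?T)"
    using d mh by (subst integral_density) auto
  also have "\<dots> = (\<integral>x. d * (h (?T x) * ln (h (?T x))) \<partial>?\<mu>)"
    using mh mT by (subst integral_distr) auto
  also have "\<dots> = (\<integral>x. f x * ln (f x) - ln d * f x \<partial>?\<mu>)"
  proof (rule Bochner_Integration.integral_cong[OF refl])
    fix x assume x: "x \<in> space ?\<mu>"
    show "d * (h (?T x) * ln (h (?T x))) = f x * ln (f x) - ln d * f x"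
    proof (cases "f x = 0")
      case False
      with pos[OF x] have "f x > 0" by simp
      with d show ?thesis unfolding hT[OF x] by (simp add: ln_div algebra_simps)
    qed (simp add: hT[OF x])
  qed
  also have "\<dots> = (\<integral>x. f x * ln (f x) \<partial>?\<mu>) - ln d"
    using int int1 by simp
  finally have eq: "(\<integral>y. h y * ln (h y) \<partial>?\<mu>) = (\<integral>x. f x * ln (f x) \<partial>?\<mu>) - ln d" .
  have "diff_entropy M n (\<lambda>\<omega>. ?T (X \<omega>)) = - (\<integral>y. h y * ln (h y) \<partial>?\<mu>)"
    unfolding diff_entropy_def using entropy_distr[OF dist hpos] by (simp add: log_def)
  moreover have "diff_entropy M n X = - (\<integral>y. f y * ln (f y) \<partial>?\<mu>)"
    unfolding diff_entropy_def using entropy_distr[OF f pos] by (simp add: log_def)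
  ultimately show ?thesis using eq ln_d by simp
qed

section \<open>Singular value decomposition\<close>

definition bilin :: "nat \<Rightarrow> (nat \<Rightarrow> nat \<Rightarrow> real) \<Rightarrow> (nat \<Rightarrow> real) \<Rightarrow> (nat \<Rightarrow> real) \<Rightarrow> real" where
  "bilin n Q x y = (\<Sum>a<n. \<Sum>b<n. x a * Q a b * y b)"

lemma bilin_left: "bilin n Q (\<lambda>a. \<alpha> * x a + \<beta> * y a) z = \<alpha> * bilin n Q x z + \<beta> * bilin n Q y z"
  by (simp add: bilin_def sum.distrib sum_distrib_left algebra_simps)

lemma bilin_right: "bilin n Q z (\<lambda>a. \<alpha> * x a + \<beta> * y a) = \<alpha> * bilin n Q z x + \<beta> * bilin n Q z y"
  by (simp add: bilin_def sum.distrib sum_distrib_left algebra_simps)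

lemma bilin_sym:
  assumes "\<And>a b. Q a b = Q b a"
  shows "bilin n Q x y = bilin n Q y x"
  unfolding bilin_def by (subst sum.swap) (intro sum.cong refl, subst assms, simp)

lemma bilin_id: "bilin n (\<lambda>a b. if a = b then 1 else 0) x y = (\<Sum>a<n. x a * y a)"
proof -
  have "(\<Sum>b<n. x a * (if a = b then 1 else 0) * y b) = (\<Sum>b<n. if a = b then x a * y b else 0)" for a
    by (intro sum.cong) auto
  then show ?thesis by (simp add: bilin_def)
qed

text \<open>Matrices are functions on all index pairs, so the entries outside the n x n block are
  pinned to 0. Unit rows bound the remaining entries by 1, which gives a closed subset of a product
  of intervals [-1, 1], compact by Tychonoff.\<close>

lemma compact_orthonormal:
  "compact {C :: nat \<Rightarrow> nat \<Rightarrow> real. orthonormal_rows n n C \<and> (\<forall>i j. i \<ge> n \<or> j \<ge> n \<longrightarrow> C i j = 0)}"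
proof -
  let ?K = "{C :: nat \<Rightarrow> nat \<Rightarrow> real. orthonormal_rows n n C \<and> (\<forall>i j. i \<ge> n \<or> j \<ge> n \<longrightarrow> C i j = 0)}"
  define A where "A = (\<lambda>i::nat. Pi\<^sub>E (UNIV::nat set) (\<lambda>j. {-1..1::real}))"
  have "compactin (product_topology (\<lambda>i. product_topology (\<lambda>j. euclidean) UNIV) UNIV) (Pi\<^sub>E UNIV A)"
    unfolding A_def compactin_PiE by auto
  then have comp: "compact (Pi\<^sub>E UNIV A)"
    by (simp add: euclidean_product_topology)
  have cont: "continuous_on UNIV (\<lambda>C :: nat \<Rightarrow> nat \<Rightarrow> real. C i j)" for i j
    by (rule continuous_on_compose2[OF continuous_on_product_coordinates continuous_on_product_coordinates]) auto
  have "closed (\<Inter>i\<in>{..<n}. \<Inter>k\<in>{..<n}. {C :: nat \<Rightarrow> nat \<Rightarrow> real. (\<Sum>j<n. C i j * C k j) = (if i = k then 1 else 0)})"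
    by (intro closed_INT ballI closed_Collect_eq continuous_on_sum continuous_on_mult continuous_on_const cont)
  moreover have "closed (\<Inter>i. \<Inter>j\<in>{j. i \<ge> n \<or> j \<ge> n}. {C :: nat \<Rightarrow> nat \<Rightarrow> real. C i j = 0})"
    by (intro closed_INT ballI closed_Collect_eq continuous_on_const cont)
  ultimately have "closed ((\<Inter>i\<in>{..<n}. \<Inter>k\<in>{..<n}. {C :: nat \<Rightarrow> nat \<Rightarrow> real. (\<Sum>j<n. C i j * C k j) = (if i = k then 1 else 0)})
      \<inter> (\<Inter>i. \<Inter>j\<in>{j. i \<ge> n \<or> j \<ge> n}. {C :: nat \<Rightarrow> nat \<Rightarrow> real. C i j = 0}))"
    by (rule closed_Int)
  also have "\<dots> = ?K" by (auto simp: orthonormal_rows_def)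
  finally have "closed ?K" .
  with comp have "compact (Pi\<^sub>E UNIV A \<inter> ?K)" by (rule compact_Int_closed)
  moreover have "?K \<subseteq> Pi\<^sub>E UNIV A"
  proof
    fix C assume C: "C \<in> ?K"
    have "\<bar>C i j\<bar> \<le> 1" for i j
    proof (cases "i < n \<and> j < n")
      case True
      then have "C i j * C i j \<le> (\<Sum>j<n. C i j * C i j)" by (intro member_le_sum) auto
      also have "\<dots> = 1" using True C by (auto simp: orthonormal_rows_def)
      finally show ?thesis by (simp add: abs_square_le_1 power2_eq_square[symmetric])
    next
      case False
      with C show ?thesis by auto
    qed
    then show "C \<in> Pi\<^sub>E UNIV A" by (auto simp: A_def abs_le_iff PiE_iff)
  qed
  ultimately show ?thesis by (simp add: Int_absorb1)
qed

text \<open>The functional \<open>\<Sum>i. i * Q(c\<^sub>i, c\<^sub>i)\<close> attains its maximum over the orthonormal frames; rotating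
  \<open>c\<^sub>i\<close> and \<open>c\<^sub>j\<close> in their plane shows that its derivative \<open>2 * (i - j) * Q(c\<^sub>i, c\<^sub>j)\<close> vanishes there.\<close>

lemma orthonormal_diagonalization:
  assumes sym: "\<And>a b. Q a b = Q b a"
  obtains C where "orthonormal_rows n n C"
    and "\<And>i j. i < n \<Longrightarrow> j < n \<Longrightarrow> i \<noteq> j \<Longrightarrow> bilin n Q (C i) (C j) = 0"
proof -
  define K where "K = {C :: nat \<Rightarrow> nat \<Rightarrow> real. orthonormal_rows n n C \<and> (\<forall>i j. i \<ge> n \<or> j \<ge> n \<longrightarrow> C i j = 0)}"
  \<comment> \<open>The weights \<open>real i\<close> must be pairwise distinct: with equal weights
    q would be a multiple of the trace of Q and constant over all orthonormal frames.\<close>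
  define q where "q C = (\<Sum>i<n. real i * bilin n Q (C i) (C i))" for C :: "nat \<Rightarrow> nat \<Rightarrow> real"
  have cont: "continuous_on UNIV (\<lambda>C :: nat \<Rightarrow> nat \<Rightarrow> real. C i j)" for i j
    by (rule continuous_on_compose2[OF continuous_on_product_coordinates continuous_on_product_coordinates]) auto
  have "continuous_on UNIV q"
    unfolding q_def bilin_def
    by (intro continuous_on_sum continuous_on_mult continuous_on_const cont)
  then have "continuous_on K q" by (rule continuous_on_subset) auto
  moreover have "compact K" unfolding K_def by (rule compact_orthonormal)
  moreover have "(\<lambda>i j. if i < n \<and> i = j then 1 else 0) \<in> K"
  proof -
    have "(\<Sum>j<n. (if i < n \<and> i = j then 1 else 0) * (if k < n \<and> k = j then 1 else (0::real))) = (if i = k then 1 else 0)"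
      if "i < n" "k < n" for i k
    proof -
      have "(\<Sum>j<n. (if i < n \<and> i = j then 1 else 0) * (if k < n \<and> k = j then 1 else (0::real))) =
        (\<Sum>j<n. if i = j then (if i = k then 1 else 0) else 0)"
        using that by (intro sum.cong) auto
      then show ?thesis using that by simp
    qed
    then show ?thesis by (auto simp: K_def orthonormal_rows_def)
  qed
  ultimately obtain C where C: "C \<in> K" and max: "\<And>C'. C' \<in> K \<Longrightarrow> q C' \<le> q C"
    using continuous_attains_sup[of K q] by blast
  have on: "orthonormal_rows n n C" and out: "\<And>i j. i \<ge> n \<or> j \<ge> n \<Longrightarrow> C i j = 0"
    using C by (auto simp: K_def)
  have "bilin n Q (C i) (C j) = 0" if ij: "i < n" "j < n" "i \<noteq> j" for i j
  proof -
    let ?x = "C i" and ?y = "C j"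
    define R where "R \<theta> = C(i := (\<lambda>a. cos \<theta> * ?x a + sin \<theta> * ?y a), j := (\<lambda>a. (- sin \<theta>) * ?x a + cos \<theta> * ?y a))" for \<theta>
    have Ri: "R \<theta> i = (\<lambda>a. cos \<theta> * ?x a + sin \<theta> * ?y a)" and Rj: "R \<theta> j = (\<lambda>a. (- sin \<theta>) * ?x a + cos \<theta> * ?y a)" for \<theta>
      using ij by (auto simp: R_def)
    have Rk: "R \<theta> k = C k" if "k \<noteq> i" "k \<noteq> j" for k \<theta> using that by (auto simp: R_def)
    \<comment> \<open>The identity form expresses the dot product as a \<open>bilin\<close>, so the
      expansion \<open>bR\<close> serves both for orthonormality of the rotated frame and for
      Q.\<close>
    let ?E = "\<lambda>a b. if a = b then 1 else (0::real)"
    have ip: "bilin n ?E (C k) (C l) = (if k = l then 1 else 0)" if "k < n" "l < n" for k l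
      using on that by (simp add: bilin_id orthonormal_rows_def)
    have bR: "bilin n P (R \<theta> i) z = cos \<theta> * bilin n P ?x z + sin \<theta> * bilin n P ?y z"
      "bilin n P (R \<theta> j) z = - sin \<theta> * bilin n P ?x z + cos \<theta> * bilin n P ?y z"
      "bilin n P z (R \<theta> i) = cos \<theta> * bilin n P z ?x + sin \<theta> * bilin n P z ?y"
      "bilin n P z (R \<theta> j) = - sin \<theta> * bilin n P z ?x + cos \<theta> * bilin n P z ?y" for P z \<theta>
      unfolding Ri Rj bilin_left bilin_right by simp_all
    have cs: "cos \<theta> * cos \<theta> + sin \<theta> * sin \<theta> = 1" for \<theta> :: real
      using sin_cos_squared_add2[of \<theta>] by (simp add: power2_eq_square)
    have "R \<theta> \<in> K" for \<theta>
    proof -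
      have "bilin n ?E (R \<theta> k) (R \<theta> l) = (if k = l then 1 else 0)" if "k < n" "l < n" for k l
        using that ij cs[of \<theta>]
        by (cases "k = i"; cases "k = j"; cases "l = i"; cases "l = j")
           (auto simp: bR Rk ip algebra_simps)
      moreover have "R \<theta> k l = 0" if "k \<ge> n \<or> l \<ge> n" for k l
        using that ij out[of k l] out[of i l] out[of j l] by (auto simp: R_def)
      ultimately show ?thesis by (simp add: K_def orthonormal_rows_def bilin_id)
    qed
    then have le: "q (R \<theta>) \<le> q C" for \<theta> by (rule max)
    \<comment> \<open>These are the only two summands of q that the rotation changes, so f inherits
      the maximum at angle 0.\<close>
    define f where "f \<theta> = real i * bilin n Q (R \<theta> i) (R \<theta> i) + real j * bilin n Q (R \<theta> j) (R \<theta> j)" for \<theta>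
    have qf: "q (R \<theta>) = f \<theta> + (\<Sum>k\<in>{..<n}-{i,j}. real k * bilin n Q (C k) (C k))" for \<theta>
    proof -
      have "q (R \<theta>) = (\<Sum>k\<in>{i,j}. real k * bilin n Q (R \<theta> k) (R \<theta> k)) + (\<Sum>k\<in>{..<n}-{i,j}. real k * bilin n Q (R \<theta> k) (R \<theta> k))"
        unfolding q_def using ij by (subst sum.subset_diff[of "{i,j}" "{..<n}"]) auto
      also have "(\<Sum>k\<in>{..<n}-{i,j}. real k * bilin n Q (R \<theta> k) (R \<theta> k)) = (\<Sum>k\<in>{..<n}-{i,j}. real k * bilin n Q (C k) (C k))"
        by (intro sum.cong) (auto simp: Rk)
      finally show ?thesis using ij by (simp add: f_def)
    qed
    have R0: "R 0 = C" by (auto simp: R_def)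
    have fmax: "f \<theta> \<le> f 0" for \<theta> using le[of \<theta>] qf[of \<theta>] qf[of 0] R0 by simp
    have f_eq: "f \<theta> = real i * (cos \<theta> * (cos \<theta> * bilin n Q ?x ?x + sin \<theta> * bilin n Q ?x ?y) + sin \<theta> * (cos \<theta> * bilin n Q ?x ?y + sin \<theta> * bilin n Q ?y ?y))
       + real j * (- sin \<theta> * (- sin \<theta> * bilin n Q ?x ?x + cos \<theta> * bilin n Q ?x ?y) + cos \<theta> * (- sin \<theta> * bilin n Q ?x ?y + cos \<theta> * bilin n Q ?y ?y))" for \<theta>
      unfolding f_def bR bilin_sym[OF sym, where x="?y" and y="?x"] by simp
    have "(f has_real_derivative 2 * (real i - real j) * bilin n Q ?x ?y) (at 0)"
      unfolding f_eq[abs_def] by (auto intro!: derivative_eq_intros simp: algebra_simps)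
    from DERIV_local_max[OF this, of 1] fmax have "2 * (real i - real j) * bilin n Q ?x ?y = 0" by auto
    with ij show ?thesis by simp
  qed
  with on show ?thesis by (rule that)
qed

text \<open>Diagonalise the Gram matrix Q of S in an orthonormal frame C. The vectors S c_i are then
  pairwise orthogonal, and nonzero by the rank hypothesis; their lengths t i are the singular values
  and their normalisations are the rows of A.\<close>

lemma thin_svd_exists:
  assumes rank: "full_column_rank l n S"
  shows "\<exists>A T C. thin_svd l n S A T C"
proof -
  define Q where "Q a b = (\<Sum>k<l. S k a * S k b)" for a b
  obtain C where C: "orthonormal_rows n n C"
    and orth: "\<And>i j. i < n \<Longrightarrow> j < n \<Longrightarrow> i \<noteq> j \<Longrightarrow> bilin n Q (C i) (C j) = 0"
    by (rule orthonormal_diagonalization[of Q n]) (auto simp: Q_def mult.commute)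
  have bQ: "bilin n Q x y = (\<Sum>k<l. (\<Sum>a<n. S k a * x a) * (\<Sum>b<n. S k b * y b))" for x y
  proof -
    have "bilin n Q x y = (\<Sum>a<n. \<Sum>b<n. \<Sum>k<l. S k a * x a * (S k b * y b))"
      by (simp add: bilin_def Q_def sum_distrib_left sum_distrib_right mult_ac)
    also have "\<dots> = (\<Sum>a<n. \<Sum>k<l. \<Sum>b<n. S k a * x a * (S k b * y b))"
      by (intro sum.cong refl sum.swap)
    also have "\<dots> = (\<Sum>k<l. \<Sum>a<n. \<Sum>b<n. S k a * x a * (S k b * y b))"
      by (rule sum.swap)
    finally show ?thesis by (simp add: sum_product)
  qed
  define t where "t i = sqrt (bilin n Q (C i) (C i))" for i
  have pos: "bilin n Q (C i) (C i) > 0" if "i < n" for i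
  proof (rule ccontr)
    assume "\<not> bilin n Q (C i) (C i) > 0"
    then have "(\<Sum>k<l. (\<Sum>a<n. S k a * C i a) * (\<Sum>b<n. S k b * C i b)) = 0"
      using sum_nonneg[of "{..<l}" "\<lambda>k. (\<Sum>a<n. S k a * C i a) * (\<Sum>b<n. S k b * C i b)"]
      by (simp add: bQ)
    then have "\<forall>k<l. (\<Sum>a<n. S k a * C i a) = 0"
      by (subst (asm) sum_nonneg_eq_0_iff) auto
    with rank have "\<forall>a<n. C i a = 0" by (auto simp: full_column_rank_def)
    then have "(\<Sum>a<n. C i a * C i a) = 0" by simp
    with C that show False by (auto simp: orthonormal_rows_def)
  qed
  have t: "t i > 0" "t i * t i = bilin n Q (C i) (C i)" if "i < n" for i
    using pos[OF that] by (auto simp: t_def)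
  define A where "A i k = (\<Sum>b<n. S k b * C i b) / t i" for i k
  define T where "T i j = (if i = j then t i else 0)" for i j :: nat
  have "orthonormal_rows n l A"
  proof -
    have "(\<Sum>j<l. A i j * A k j) = (if i = k then 1 else 0)" if ik: "i < n" "k < n" for i k
    proof -
      have "(\<Sum>j<l. A i j * A k j) = bilin n Q (C i) (C k) / (t i * t k)"
        unfolding A_def bQ times_divide_times_eq by (rule sum_divide_distrib[symmetric])
      also have "\<dots> = (if i = k then 1 else 0)"
        using ik orth[OF ik] t[of i] pos[of i] by auto
      finally show ?thesis .
    qed
    then show ?thesis by (simp add: orthonormal_rows_def)
  qed
  moreover have "S k j = mat_mult n (mat_mult n (Defs.transpose_mat A) T) C k j" if "k < l" "j < n" for k j
  proof -
    have "mat_mult n (mat_mult n (Defs.transpose_mat A) T) C k j = (\<Sum>m<n. (\<Sum>p<n. if p = m then A p k * t p else 0) * C m j)"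
      unfolding mat_mult_def Defs.transpose_mat_def T_def
      by (intro sum.cong arg_cong2[where f="(*)"] refl) auto
    also have "\<dots> = (\<Sum>m<n. A m k * t m * C m j)" by simp
    also have "\<dots> = (\<Sum>m<n. \<Sum>b<n. S k b * (C m b * C m j))"
    proof (rule sum.cong[OF refl])
      fix m assume "m \<in> {..<n}"
      then have "A m k * t m = (\<Sum>b<n. S k b * C m b)" using t(1)[of m] by (simp add: A_def)
      then show "A m k * t m * C m j = (\<Sum>b<n. S k b * (C m b * C m j))"
        by (simp add: sum_distrib_right mult.assoc)
    qed
    also have "\<dots> = (\<Sum>b<n. S k b * (\<Sum>m<n. C m b * C m j))"
      by (subst sum.swap) (simp add: sum_distrib_left)
    also have "\<dots> = (\<Sum>b<n. if b = j then S k b else 0)"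
      using orthonormal_rows_transpose[OF C] that
      by (intro sum.cong) (auto simp: orthonormal_rows_def Defs.transpose_mat_def)
    also have "\<dots> = S k j" using that by simp
    finally show ?thesis by simp
  qed
  ultimately have "thin_svd l n S A T C"
    using C by (auto simp: thin_svd_def T_def)
  then show ?thesis by blast
qed

section \<open>Gram determinants of shifted polynomials\<close>

text \<open>When N exceeds both degrees this is, by Parseval, the normalised L2 inner product of f
  and h on the unit circle.\<close>

definition coeff_inner :: "nat \<Rightarrow> complex poly \<Rightarrow> complex poly \<Rightarrow> complex" where
  "coeff_inner N f h = (\<Sum>k<N. cnj (coeff f k) * coeff h k)"

text \<open>A root z with 0 < |z| < 1 is moved to 1 / cnj z, and z = 0 gives the constant 1. The
  result has the modulus of w - z on the unit circle and no root in the open unit disc.\<close>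

definition reflect_factor :: "complex \<Rightarrow> complex poly" where
  "reflect_factor z = (if cmod z < 1 then [:1, - cnj z:] else [:- z, 1:])"

text \<open>On the unit circle |w - z| = |1 - cnj z * w|.\<close>

lemma coeff_inner_reflect:
  assumes f: "\<And>k. k \<ge> m \<Longrightarrow> coeff f k = 0"
  shows "coeff_inner (Suc m) ([:- z, 1:] * f) ([:- z, 1:] * h) =
         coeff_inner (Suc m) ([:1, - cnj z:] * f) ([:1, - cnj z:] * h)"
proof -
  let ?F = "coeff f" and ?H = "coeff h" and ?F' = "coeff (pCons 0 f)" and ?H' = "coeff (pCons 0 h)"
  have c: "coeff ([:a, b:] * e) k = a * coeff e k + b * coeff (pCons 0 e) k" for a b e k
    by (simp add: coeff_pCons split: nat.split)
  define A where "A = (\<Sum>k<Suc m. cnj (?F k) * ?H k)"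
  define A' where "A' = (\<Sum>k<Suc m. cnj (?F' k) * ?H' k)"
  define B where "B = (\<Sum>k<Suc m. cnj (?F' k) * ?H k)"
  define B' where "B' = (\<Sum>k<Suc m. cnj (?F k) * ?H' k)"
  \<comment> \<open>The two products differ only by exchanging A and A'. Shifting the index turns A'
    into A without its last term, which vanishes because \<open>coeff f m = 0\<close>.\<close>
  have "A' = (\<Sum>k<m. cnj (?F k) * ?H k)"
    unfolding A'_def by (subst sum.lessThan_Suc_shift) simp
  also have "\<dots> = A" unfolding A_def using f[of m] by simp
  finally have "A' = A" .
  have "coeff_inner (Suc m) ([:- z, 1:] * f) ([:- z, 1:] * h) = cnj z * z * A - z * B - cnj z * B' + A'"
    unfolding coeff_inner_def c A_def A'_def B_def B'_def
    by (simp only: sum_distrib_left sum.distrib[symmetric] sum_subtractf[symmetric])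
       (intro sum.cong refl, simp add: algebra_simps)
  moreover have "coeff_inner (Suc m) ([:1, - cnj z:] * f) ([:1, - cnj z:] * h) = A - z * B - cnj z * B' + cnj z * z * A'"
    unfolding coeff_inner_def c A_def A'_def B_def B'_def
    by (simp only: sum_distrib_left sum.distrib[symmetric] sum_subtractf[symmetric])
       (intro sum.cong refl, simp add: algebra_simps)
  ultimately show ?thesis using \<open>A' = A\<close> by simp
qed

lemma degree_prod_linear_le:
  assumes "\<And>z. degree (F z) \<le> 1"
  shows "degree (\<Prod>z\<leftarrow>as. F z) \<le> length as"
proof (induction as)
  case (Cons z as)
  have "degree (F z * (\<Prod>z\<leftarrow>as. F z)) \<le> degree (F z) + degree (\<Prod>z\<leftarrow>as. F z)" by (rule degree_mult_le)
  with Cons assms[of z] show ?case by simp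
qed simp

lemma degree_reflect_factor: "degree (reflect_factor z) \<le> 1"
  by (simp add: reflect_factor_def)

text \<open>Factors are exchanged one at a time while the others are absorbed into f and h, hence
  the generalisation over f and h. The degree bounds ensure that cutting at N never loses a
  coefficient.\<close>

lemma coeff_inner_reflect_prod:
  assumes "degree f + length as < N" "degree h + length as < N"
  shows "coeff_inner N ((\<Prod>z\<leftarrow>as. [:- z, 1:]) * f) ((\<Prod>z\<leftarrow>as. [:- z, 1:]) * h) =
         coeff_inner N ((\<Prod>z\<leftarrow>as. reflect_factor z) * f) ((\<Prod>z\<leftarrow>as. reflect_factor z) * h)"
  using assms
proof (induction as arbitrary: f h)
  case (Cons z as)
  let ?P = "\<Prod>z\<leftarrow>as. [:- z, 1:]" and ?R = "\<Prod>z\<leftarrow>as. reflect_factor z"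
  have d: "degree ([:- z, 1:] * e) \<le> Suc (degree e)" for e
    using degree_mult_le[of "[:- z, 1:]" e] by simp
  have "coeff_inner N (?P * ([:- z, 1:] * f)) (?P * ([:- z, 1:] * h)) = coeff_inner N (?R * ([:- z, 1:] * f)) (?R * ([:- z, 1:] * h))"
    using Cons.prems d[of f] d[of h] by (intro Cons.IH) auto
  also have "\<dots> = coeff_inner N ([:- z, 1:] * (?R * f)) ([:- z, 1:] * (?R * h))"
    by (simp only: mult.left_commute)
  also have "\<dots> = coeff_inner N (reflect_factor z * (?R * f)) (reflect_factor z * (?R * h))"
  proof (cases "cmod z < 1")
    case True
    obtain m where N: "N = Suc m" using Cons.prems by (cases N) auto
    have "degree (?R * f) \<le> length as + degree f"
      using degree_mult_le[of ?R f] degree_prod_linear_le[of reflect_factor as, OF degree_reflect_factor] by linarith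
    then have "coeff (?R * f) k = 0" if "k \<ge> m" for k
      using that Cons.prems N by (intro coeff_eq_0) auto
    from coeff_inner_reflect[OF this] True show ?thesis by (simp only: N reflect_factor_def if_True)
  qed (simp only: reflect_factor_def if_False)
  finally show ?case by (simp only: list.map prod_list.Cons mult_ac)
qed simp

text \<open>Each factor is \<alpha> + \<beta> X with |\<beta>| <= |\<alpha>| and |\<alpha>| >= 1, so
  its inverse is a geometric series with coefficients of modulus at most 1. Each further Cauchy
  product costs at most a factor k + 1. Roots on the unit circle are allowed, so the bound is
  polynomial and not geometric.\<close>

lemma prod_reflect_factor_inverse:
  obtains q :: "complex fps" where "fps_of_poly (\<Prod>z\<leftarrow>as. reflect_factor z) * q = 1"
    and "\<And>k. cmod (fps_nth q k) \<le> real (Suc k) ^ length as"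
proof -
  have "\<exists>q. fps_of_poly (\<Prod>z\<leftarrow>as. reflect_factor z) * q = 1 \<and> (\<forall>k. cmod (fps_nth q k) \<le> real (Suc k) ^ length as)"
  proof (induction as)
    case Nil
    show ?case by (intro exI[of _ 1]) auto
  next
    case (Cons z as)
    then obtain q where q: "fps_of_poly (\<Prod>z\<leftarrow>as. reflect_factor z) * q = 1"
      and bound: "\<And>k. cmod (fps_nth q k) \<le> real (Suc k) ^ length as" by auto
    obtain \<alpha> \<beta> where \<alpha>\<beta>: "reflect_factor z = [:\<alpha>, \<beta>:]" "cmod \<alpha> \<ge> 1" "cmod \<beta> \<le> cmod \<alpha>"
      by (cases "cmod z < 1") (auto simp: reflect_factor_def)
    have nz: "\<alpha> \<noteq> 0" using \<alpha>\<beta>(2) by auto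
    define x where "x = Abs_fps (\<lambda>k. (- \<beta>) ^ k / \<alpha> ^ Suc k)"
    have x1: "fps_of_poly (reflect_factor z) * x = 1"
    proof (rule fps_ext)
      fix k
      show "fps_nth (fps_of_poly (reflect_factor z) * x) k = fps_nth 1 k"
        using nz by (cases k) (simp_all add: \<alpha>\<beta>(1) fps_of_poly_pCons distrib_right x_def mult.assoc field_simps)
    qed
    have xb: "cmod (fps_nth x k) \<le> 1" for k
    proof -
      have "cmod (fps_nth x k) = (cmod \<beta> / cmod \<alpha>) ^ k / cmod \<alpha>"
        by (simp add: x_def norm_divide norm_power norm_mult power_divide)
      also have "\<dots> \<le> 1 / 1"
        using \<alpha>\<beta> by (intro frac_le power_le_one) (auto simp: divide_le_eq)
      finally show ?thesis by simp
    qed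
    have "cmod (fps_nth (x * q) k) \<le> real (Suc k) ^ length (z # as)" for k
    proof -
      have "cmod (fps_nth (x * q) k) \<le> (\<Sum>i=0..k. cmod (fps_nth x i) * cmod (fps_nth q (k - i)))"
        unfolding fps_mult_nth by (rule order_trans[OF norm_sum]) (simp add: norm_mult)
      also have "\<dots> \<le> (\<Sum>i=0..k. 1 * real (Suc k) ^ length as)"
      proof (intro sum_mono mult_mono xb)
        fix i
        have "cmod (fps_nth q (k - i)) \<le> real (Suc (k - i)) ^ length as" by (rule bound)
        also have "\<dots> \<le> real (Suc k) ^ length as" by (intro power_mono) auto
        finally show "cmod (fps_nth q (k - i)) \<le> real (Suc k) ^ length as" .
      qed auto
      finally show ?thesis by simp
    qed
    moreover have "fps_of_poly (\<Prod>z\<leftarrow>z # as. reflect_factor z) * (x * q) =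
        (fps_of_poly (reflect_factor z) * x) * (fps_of_poly (\<Prod>z\<leftarrow>as. reflect_factor z) * q)"
      by (simp add: fps_of_poly_mult mult_ac)
    ultimately show ?case using x1 q by (intro exI[of _ "x * q"]) auto
  qed
  then show ?thesis using that by blast
qed

section \<open>Determinant estimates for complex matrices\<close>

lemma norm_det_le:
  fixes A :: "complex mat"
  assumes A: "A \<in> carrier_mat n n" and b: "\<And>i j. i < n \<Longrightarrow> j < n \<Longrightarrow> cmod (A $$ (i,j)) \<le> b"
  shows "cmod (det A) \<le> fact n * b ^ n"
proof -
  \<comment> \<open>The crude Leibniz bound is enough, because it is later applied to a matrix whose
    size stays fixed.\<close>
  have "cmod (det A) \<le> (\<Sum>p | p permutes {0..<n}. cmod (signof p * (\<Prod>i = 0..<n. A $$ (i, p i))))"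
    unfolding det_def'[OF A] by (rule norm_sum)
  also have "\<dots> \<le> (\<Sum>p | p permutes {0..<n}. b ^ n)"
  proof (rule sum_mono)
    fix p assume "p \<in> {p. p permutes {0..<n}}"
    then have p: "p permutes {0..<n}" by simp
    have "cmod (signof p * (\<Prod>i = 0..<n. A $$ (i, p i))) = (\<Prod>i = 0..<n. cmod (A $$ (i, p i)))"
      by (simp add: norm_mult prod_norm[symmetric] sign_def)
    also have "\<dots> \<le> (\<Prod>i = 0..<n. b)"
      using b permutes_in_image[OF p] by (intro prod_mono) auto
    finally show "cmod (signof p * (\<Prod>i = 0..<n. A $$ (i, p i))) \<le> b ^ n" by simp
  qed
  also have "\<dots> = fact n * b ^ n" by (simp add: card_permutations[OF refl])
  finally show ?thesis .
qed

definition adj :: "complex mat \<Rightarrow> complex mat" where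
  "adj A = mat (dim_col A) (dim_row A) (\<lambda>(i,j). cnj (A $$ (j,i)))"

lemma adj_carrier [simp]: "A \<in> carrier_mat m n \<Longrightarrow> adj A \<in> carrier_mat n m"
  by (auto simp: adj_def)

lemma dim_adj [simp]: "dim_row (adj A) = dim_col A" "dim_col (adj A) = dim_row A"
  by (auto simp: adj_def)

lemma adj_mult:
  assumes "A \<in> carrier_mat m n" "B \<in> carrier_mat n k"
  shows "adj (A * B) = adj B * adj A"
  using assms by (intro eq_matI) (auto simp: adj_def scalar_prod_def mult.commute)

lemma det_adj:
  assumes "A \<in> carrier_mat n n"
  shows "det (adj A) = cnj (det A)"
proof -
  interpret cnj: comm_ring_hom cnj by unfold_locales auto
  have "adj A = map_mat cnj (transpose_mat A)" using assms by (auto simp: adj_def)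
  then show ?thesis using det_transpose[OF assms] by (simp add: cnj.hom_det)
qed

text \<open>An eigenvector v of 1 + K adj K with eigenvalue a satisfies a |v|^2 = |v|^2 + |adj K
  v|^2, so |a| >= 1; the determinant is the product of the eigenvalues.\<close>

lemma norm_det_one_plus_ge_1:
  assumes K: "K \<in> carrier_mat m n"
  shows "cmod (det (1\<^sub>m m + K * adj K)) \<ge> 1"
proof -
  let ?P = "1\<^sub>m m + K * adj K"
  have P: "?P \<in> carrier_mat m m" using K by auto
  obtain as where as: "char_poly ?P = (\<Prod>a\<leftarrow>as. [:- a, 1:])" "length as = m"
    using char_poly_factorized[OF P] by auto
  have ev: "cmod a \<ge> 1" if "a \<in> set as" for a
  proof -
    have "poly (char_poly ?P) a = 0" unfolding as using that by (induction as) auto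
    then obtain v where v: "v \<in> carrier_vec m" "v \<noteq> 0\<^sub>v m" "?P *\<^sub>v v = a \<cdot>\<^sub>v v"
      using eigenvalue_root_char_poly[OF P, of a] K by (auto simp: eigenvalue_def eigenvector_def)
    \<comment> \<open>The vector w is adj K v, and X and Y are the squared norms of v and w.\<close>
    define w where "w j = (\<Sum>i<m. cnj (K $$ (i,j)) * v $ i)" for j
    define X where "X = (\<Sum>i<m. (cmod (v $ i))\<^sup>2)"
    define Y where "Y = (\<Sum>j<n. (cmod (w j))\<^sup>2)"
    have row: "a * v $ i = v $ i + (\<Sum>j<n. K $$ (i,j) * w j)" if i: "i < m" for i
    proof -
      have "a * v $ i = (?P *\<^sub>v v) $ i" using v i by simp
      also have "\<dots> = (\<Sum>k<m. (if i = k then 1 else 0) * v $ k + (\<Sum>j<n. K $$ (i,j) * cnj (K $$ (k,j))) * v $ k)"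
        using K v(1) i
        by (auto simp: scalar_prod_def adj_def lessThan_atLeast0 distrib_right intro!: sum.cong)
      also have "\<dots> = (\<Sum>k<m. if i = k then v $ k else 0) + (\<Sum>k<m. \<Sum>j<n. K $$ (i,j) * (cnj (K $$ (k,j)) * v $ k))"
        unfolding sum.distrib
        by (intro arg_cong2[where f="(+)"] sum.cong refl) (auto simp: sum_distrib_right mult.assoc)
      also have "(\<Sum>k<m. \<Sum>j<n. K $$ (i,j) * (cnj (K $$ (k,j)) * v $ k)) = (\<Sum>j<n. K $$ (i,j) * w j)"
        by (subst sum.swap) (simp add: w_def sum_distrib_left)
      finally show ?thesis using i by simp
    qed
    have "a * of_real X = (\<Sum>i<m. cnj (v $ i) * (a * v $ i))"
      unfolding X_def of_real_sum sum_distrib_left complex_norm_square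
      by (intro sum.cong) (auto simp: mult_ac)
    also have "\<dots> = (\<Sum>i<m. cnj (v $ i) * v $ i) + (\<Sum>i<m. \<Sum>j<n. cnj (v $ i) * (K $$ (i,j) * w j))"
      by (simp add: row distrib_left sum.distrib sum_distrib_left)
    also have "(\<Sum>i<m. cnj (v $ i) * v $ i) = of_real X"
      unfolding X_def of_real_sum complex_norm_square by (simp add: mult.commute)
    also have "(\<Sum>i<m. \<Sum>j<n. cnj (v $ i) * (K $$ (i,j) * w j)) = (\<Sum>j<n. cnj (w j) * w j)"
    proof (subst sum.swap, rule sum.cong[OF refl])
      fix j
      have "cnj (w j) = (\<Sum>i<m. cnj (v $ i) * K $$ (i,j))" by (simp add: w_def mult.commute)
      then show "(\<Sum>i<m. cnj (v $ i) * (K $$ (i,j) * w j)) = cnj (w j) * w j"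
        by (simp only: sum_distrib_right mult.assoc)
    qed
    also have "\<dots> = of_real Y"
      unfolding Y_def of_real_sum complex_norm_square by (simp add: mult.commute)
    finally have eq: "a * of_real X = of_real (X + Y)" by simp
    have "X > 0"
    proof -
      have "\<exists>i<m. v $ i \<noteq> 0" using v by (metis carrier_vecD eq_vecI index_zero_vec)
      then obtain i where "i < m" "v $ i \<noteq> 0" by auto
      then show ?thesis unfolding X_def by (intro sum_pos2[of _ i]) auto
    qed
    moreover have "Y \<ge> 0" unfolding Y_def by (intro sum_nonneg) auto
    moreover have "cmod a * X = X + Y"
      using arg_cong[OF eq, of cmod] \<open>X > 0\<close> \<open>Y \<ge> 0\<close> by (simp add: norm_mult del: of_real_add)
    ultimately have "1 * X \<le> cmod a * X" by simp
    with \<open>X > 0\<close> show ?thesis by (simp only: mult_le_cancel_right_pos)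
  qed
  \<comment> \<open>At 0 the characteristic polynomial gives the determinant up to the sign (-1)^m,
    and its factorisation gives the product of the eigenvalues up to sign.\<close>
  have "poly (char_poly ?P) 0 = det (- char_matrix ?P 0)" by (rule char_poly_matrix[OF P])
  also have "- char_matrix ?P 0 = (-1) \<cdot>\<^sub>m ?P"
  proof -
    have "- char_matrix R 0 = (-1) \<cdot>\<^sub>m R" if "R \<in> carrier_mat m m" for R :: "complex mat"
      using that by (intro eq_matI) (auto simp: char_matrix_def)
    from this[OF P] show ?thesis .
  qed
  also have "det \<dots> = (-1) ^ m * det ?P" using P by (simp only: det_smult carrier_matD)
  finally have "cmod (det ?P) = cmod (poly (char_poly ?P) 0)" by (simp add: norm_mult norm_power)
  also have "\<dots> = (\<Prod>a\<leftarrow>as. cmod a)" unfolding as(1) by (induction as) (auto simp: norm_mult)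
  also have "\<dots> \<ge> 1" using ev
  proof (induction as)
    case (Cons a as)
    have "1 * 1 \<le> cmod a * (\<Prod>a\<leftarrow>as. cmod a)" using Cons by (intro mult_mono) auto
    then show ?case by simp
  qed simp
  finally show ?thesis .
qed

text \<open>Sylvester's identity: multiplying the block matrix \<open>?M\<close> by the unipotent
  \<open>?U\<close> on the left or on the right yields block triangular matrices with the two
  determinants. It trades an n x n determinant for one of fixed size.\<close>

lemma det_one_plus_mult_commute:
  fixes K :: "'a :: field mat"
  assumes K: "K \<in> carrier_mat m n" and L: "L \<in> carrier_mat n m"
  shows "det (1\<^sub>m n + L * K) = det (1\<^sub>m m + K * L)"
proof -
  let ?M = "four_block_mat (1\<^sub>m n) (- L) K (1\<^sub>m m)" and ?U = "four_block_mat (1\<^sub>m n) L (0\<^sub>m m n) (1\<^sub>m m)"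
  have M: "?M \<in> carrier_mat (n + m) (n + m)" and U: "?U \<in> carrier_mat (n + m) (n + m)" using K L by auto
  \<comment> \<open>The left sides are the unsimplified blocks that
    \<open>mult_four_block_mat\<close> produces for the two products.\<close>
  have e: "1\<^sub>m n * 1\<^sub>m n + L * K = 1\<^sub>m n + L * K" "1\<^sub>m n * (- L) + L * 1\<^sub>m m = 0\<^sub>m n m"
    "0\<^sub>m m n * 1\<^sub>m n + 1\<^sub>m m * K = K" "0\<^sub>m m n * (- L) + 1\<^sub>m m * 1\<^sub>m m = 1\<^sub>m m"
    "1\<^sub>m n * 1\<^sub>m n + (- L) * 0\<^sub>m m n = 1\<^sub>m n" "1\<^sub>m n * L + (- L) * 1\<^sub>m m = 0\<^sub>m n m"
    "K * 1\<^sub>m n + 1\<^sub>m m * 0\<^sub>m m n = K" "K * L + 1\<^sub>m m * 1\<^sub>m m = 1\<^sub>m m + K * L"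
    using K L by (auto simp: left_mult_one_mat[of _ n m] right_mult_one_mat[of _ n m] left_mult_zero_mat[of _ n m] right_mult_zero_mat[of _ n m] comm_add_mat[of _ m m])
  have "?U * ?M = four_block_mat (1\<^sub>m n * 1\<^sub>m n + L * K) (1\<^sub>m n * (- L) + L * 1\<^sub>m m) (0\<^sub>m m n * 1\<^sub>m n + 1\<^sub>m m * K) (0\<^sub>m m n * (- L) + 1\<^sub>m m * 1\<^sub>m m)"
    using K L by (intro mult_four_block_mat) auto
  also have "\<dots> = four_block_mat (1\<^sub>m n + L * K) (0\<^sub>m n m) K (1\<^sub>m m)" by (simp only: e)
  finally have UM: "det (?U * ?M) = det (1\<^sub>m n + L * K) * det (1\<^sub>m m :: 'a mat)"
    using K L by (simp add: det_four_block_mat_upper_right_zero[OF _ refl, of _ n _ m])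
  have "?M * ?U = four_block_mat (1\<^sub>m n * 1\<^sub>m n + (- L) * 0\<^sub>m m n) (1\<^sub>m n * L + (- L) * 1\<^sub>m m) (K * 1\<^sub>m n + 1\<^sub>m m * 0\<^sub>m m n) (K * L + 1\<^sub>m m * 1\<^sub>m m)"
    using K L by (intro mult_four_block_mat) auto
  also have "\<dots> = four_block_mat (1\<^sub>m n) (0\<^sub>m n m) K (1\<^sub>m m + K * L)" by (simp only: e)
  finally have MU: "det (?M * ?U) = det (1\<^sub>m n :: 'a mat) * det (1\<^sub>m m + K * L)"
    using K L by (simp add: det_four_block_mat_upper_right_zero[OF _ refl, of _ n _ m])
  have "det (?U * ?M) = det (?M * ?U)"
    using det_mult[OF U M] det_mult[OF M U] by simp
  with UM MU show ?thesis by simp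
qed

text \<open>E and s are fixed before n, so after taking logarithms and dividing by n only the factor
  |Q 0|^(2 n) contributes to the limit.\<close>

lemma gram_det_bounds:
  fixes a :: complex and as :: "complex list"
  assumes Q: "Q = Polynomial.smult a (\<Prod>z\<leftarrow>as. reflect_factor z)" and a: "a \<noteq> 0"
  obtains E s where "\<And>n. n \<ge> 1 \<Longrightarrow>
      cmod (coeff Q 0) ^ (2 * n) \<le> cmod (det (mat n n (\<lambda>(i,j). coeff_inner (n + \<eta>) (Polynomial.monom 1 i * Q) (Polynomial.monom 1 j * Q))))"
    "\<And>n. n \<ge> 1 \<Longrightarrow> cmod (det (mat n n (\<lambda>(i,j). coeff_inner (n + \<eta>) (Polynomial.monom 1 i * Q) (Polynomial.monom 1 j * Q))))
        \<le> E * real n ^ s * cmod (coeff Q 0) ^ (2 * n)"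
    "cmod (coeff Q 0) > 0"
proof -
  obtain q0 :: "complex fps" where q0: "fps_of_poly (\<Prod>z\<leftarrow>as. reflect_factor z) * q0 = 1"
    and q0b: "\<And>k. cmod (fps_nth q0 k) \<le> real (Suc k) ^ length as"
    by (rule prod_reflect_factor_inverse[of as]) blast
  \<comment> \<open>The coefficients of the power series 1 / Q, as \<open>conv\<close>
    states.\<close>
  define q where "q k = fps_nth q0 k / a" for k
  have conv: "(\<Sum>i=0..m. coeff Q i * q (m - i)) = (if m = 0 then 1 else 0)" for m
  proof -
    have "(\<Sum>i=0..m. coeff Q i * q (m - i)) = fps_nth (fps_of_poly (\<Prod>z\<leftarrow>as. reflect_factor z) * q0) m"
      unfolding fps_mult_nth using a by (intro sum.cong) (auto simp: Q q_def)
    then show ?thesis by (simp add: q0)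
  qed
  have qb: "cmod (q k) \<le> real (Suc k) ^ length as / cmod a" for k
    using q0b[of k] by (simp add: q_def norm_divide divide_right_mono)
  have c1: "coeff Q 0 * q 0 = 1" using conv[of 0] by simp
  then have cpos: "cmod (coeff Q 0) > 0" by auto
  have cq: "cmod (coeff Q 0) * cmod (q 0) = 1" using c1 by (metis norm_mult norm_one)
  define b where "b = (\<Sum>i\<le>degree Q. cmod (coeff Q i))"
  have b: "cmod (coeff Q i) \<le> b" for i
  proof (cases "i \<le> degree Q")
    case True
    then show ?thesis unfolding b_def by (intro member_le_sum) auto
  next
    case False
    then have "coeff Q i = 0" by (intro coeff_eq_0) auto
    then show ?thesis unfolding b_def by (simp add: sum_nonneg)
  qed
  define d where "d = length as"
  define e where "e = b / cmod a"
  \<comment> \<open>E and s collect the bound \<open>norm_det_le\<close> for an \<eta> x \<eta>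
    matrix with entries at most (1 + e^2) n^(2 d + 3).\<close>
  define E where "E = fact \<eta> * (1 + e\<^sup>2) ^ \<eta>"
  define s where "s = (2 * d + 3) * \<eta>"
  \<comment> \<open>The witness x is |det (1 + K adj K)|, where K consists of the last \<eta> rows
    of X below.\<close>
  have main: "\<exists>x. cmod (det (mat n n (\<lambda>(i,j). coeff_inner (n + \<eta>) (Polynomial.monom 1 i * Q) (Polynomial.monom 1 j * Q)))) = x * cmod (coeff Q 0) ^ (2 * n)
      \<and> 1 \<le> x \<and> x \<le> E * real n ^ s" if n: "n \<ge> 1" for n
  proof -
    define S where "S = mat (n + \<eta>) n (\<lambda>(k,j). coeff (Polynomial.monom 1 j * Q) k)"
    \<comment> \<open>The lower triangular Toeplitz matrix of 1 / Q; its diagonal entries are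
      \<open>q 0\<close> = 1 / Q(0).\<close>
    define N where "N = mat n n (\<lambda>(l,j). if j \<le> l then q (l - j) else 0)"
    define X where "X = S * N"
    define K where "K = mat \<eta> n (\<lambda>(i,j). X $$ (n + i, j))"
    define G where "G = mat n n (\<lambda>(i,j). coeff_inner (n + \<eta>) (Polynomial.monom 1 i * Q) (Polynomial.monom 1 j * Q))"
    have car: "S \<in> carrier_mat (n + \<eta>) n" "N \<in> carrier_mat n n" "X \<in> carrier_mat (n + \<eta>) n"
      "K \<in> carrier_mat \<eta> n" "G \<in> carrier_mat n n"
      by (auto simp: S_def N_def X_def K_def G_def)
    have X_entry: "X $$ (k,j) = (\<Sum>l<n. (if k < l then 0 else coeff Q (k - l)) * (if j \<le> l then q (l - j) else 0))"
      if "k < n + \<eta>" "j < n" for k j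
      using that by (auto simp: X_def S_def N_def scalar_prod_def lessThan_atLeast0 coeff_monom_mult intro!: sum.cong)
    \<comment> \<open>In the first n rows of S N the full convolution of Q with 1 / Q appears, which
      gives an identity block; truncation is felt only in the remaining \<eta> rows.\<close>
    have X_top: "X $$ (k,j) = (if k = j then 1 else 0)" if kj: "k < n" "j < n" for k j
    proof -
      have "X $$ (k,j) = (\<Sum>l<n. (if k < l then 0 else coeff Q (k - l)) * (if j \<le> l then q (l - j) else 0))"
        using kj by (intro X_entry) auto
      also have "\<dots> = (\<Sum>l\<in>{j..k}. coeff Q (k - l) * q (l - j))"
        using kj by (intro sum.mono_neutral_cong_right) auto
      also have "\<dots> = (if k = j then 1 else 0)"
      proof (cases "j \<le> k")
        case True
        then have "(\<Sum>l\<in>{j..k}. coeff Q (k - l) * q (l - j)) = (\<Sum>i=0..k-j. coeff Q i * q (k - j - i))"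
          by (intro sum.reindex_bij_witness[of _ "\<lambda>i. k - i" "\<lambda>l. k - l"]) auto
        also have "\<dots> = (if k - j = 0 then 1 else 0)" by (rule conv)
        finally show ?thesis using True by simp
      qed auto
      finally show ?thesis .
    qed
    have G_eq: "G = adj S * S"
      by (intro eq_matI) (auto simp: G_def S_def adj_def scalar_prod_def coeff_inner_def lessThan_atLeast0)
    have "adj X * X = 1\<^sub>m n + adj K * K"
    proof (rule eq_matI)
      fix i j assume "i < dim_row (1\<^sub>m n + adj K * K)" "j < dim_col (1\<^sub>m n + adj K * K)"
      then have ij: "i < n" "j < n" using car by auto
      have "(adj X * X) $$ (i,j) = (\<Sum>k=0..<n+\<eta>. cnj (X $$ (k,i)) * X $$ (k,j))"
        using ij car by (simp add: adj_def scalar_prod_def)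
      also have "\<dots> = (\<Sum>k=0..<n. cnj (X $$ (k,i)) * X $$ (k,j)) + (\<Sum>k=n..<n+\<eta>. cnj (X $$ (k,i)) * X $$ (k,j))"
        by (rule sum.atLeastLessThan_concat[symmetric]) auto
      also have "(\<Sum>k=0..<n. cnj (X $$ (k,i)) * X $$ (k,j)) = (\<Sum>k=0..<n. if k = i then (if i = j then 1 else 0) else 0)"
        using ij by (intro sum.cong) (auto simp: X_top)
      also have "\<dots> = (if i = j then 1 else 0)" using ij by simp
      also have "(\<Sum>k=n..<n+\<eta>. cnj (X $$ (k,i)) * X $$ (k,j)) = (\<Sum>k=0..<\<eta>. cnj (K $$ (k,i)) * K $$ (k,j))"
        using ij by (intro sum.reindex_bij_witness[of _ "\<lambda>k. n + k" "\<lambda>k. k - n"]) (auto simp: K_def)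
      finally show "(adj X * X) $$ (i,j) = (1\<^sub>m n + adj K * K) $$ (i,j)"
        using ij car by (simp add: adj_def scalar_prod_def)
    qed (use car in \<open>auto simp: adj_def\<close>)
    moreover have "adj X * X = adj N * G * N"
      using car adj_mult[OF car(1,2)] unfolding X_def G_eq
      by (simp add: assoc_mult_mat[of _ n n _ "n + \<eta>" _ n] assoc_mult_mat[of _ n "n + \<eta>" _ n _ n] assoc_mult_mat[of _ n n _ n _ n])
    ultimately have "det (adj N * G * N) = det (1\<^sub>m \<eta> + K * adj K)"
      using det_one_plus_mult_commute[OF car(4) adj_carrier[OF car(4)]] by simp
    moreover have "det (adj N * G * N) = cnj (det N) * det G * det N"
      by (simp only: det_mult[OF mult_carrier_mat[OF adj_carrier[OF car(2)] car(5)] car(2)]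
          det_mult[OF adj_carrier[OF car(2)] car(5)] det_adj[OF car(2)])
    moreover have "det N = q 0 ^ n"
    proof -
      have "det N = prod_list (diag_mat N)"
        by (rule det_lower_triangular[OF _ car(2)]) (auto simp: N_def)
      also have "diag_mat N = replicate n (q 0)"
        by (rule nth_equalityI) (auto simp: diag_mat_def N_def)
      finally show ?thesis by simp
    qed
    ultimately have det: "cmod (q 0) ^ n * cmod (det G) * cmod (q 0) ^ n = cmod (det (1\<^sub>m \<eta> + K * adj K))"
      by (metis norm_mult complex_mod_cnj norm_power)
    define x where "x = cmod (det (1\<^sub>m \<eta> + K * adj K))"
    have "x * cmod (coeff Q 0) ^ (2 * n) = cmod (det G) * (cmod (coeff Q 0) * cmod (q 0)) ^ (2 * n)"
      unfolding x_def det[symmetric] power_mult_distrib by (simp add: mult_2 power_add)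
    then have "cmod (det G) = x * cmod (coeff Q 0) ^ (2 * n)" by (simp add: cq)
    moreover have "1 \<le> x" unfolding x_def by (rule norm_det_one_plus_ge_1[OF car(4)])
    moreover have "x \<le> E * real n ^ s"
    proof -
      \<comment> \<open>An entry of K is a sum of n terms, each at most b n^d / |a|. An entry of K
        adj K is then at most n y^2 = e^2 n^(2 d + 3).\<close>
      define y where "y = e * real n ^ (d + 1)"
      have b0: "b \<ge> 0" using b[of 0] norm_ge_zero order_trans by blast
      have e0: "e \<ge> 0" unfolding e_def using b0 by simp
      have Kb: "cmod (K $$ (i,j)) \<le> y" if ij: "i < \<eta>" "j < n" for i j
      proof -
        have "cmod (K $$ (i,j)) \<le> (\<Sum>l<n. cmod ((if n + i < l then 0 else coeff Q (n + i - l)) * (if j \<le> l then q (l - j) else 0)))"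
          using ij by (simp add: K_def X_entry norm_sum)
        also have "\<dots> \<le> (\<Sum>l<n. b * (real n ^ d / cmod a))"
        proof (rule sum_mono)
          fix l assume l: "l \<in> {..<n}"
          have "cmod (q (l - j)) \<le> real (Suc (l - j)) ^ d / cmod a" using qb by (simp add: d_def)
          also have "\<dots> \<le> real n ^ d / cmod a"
            using l by (intro divide_right_mono power_mono) auto
          finally have "cmod (if j \<le> l then q (l - j) else 0) \<le> real n ^ d / cmod a" by auto
          moreover have "cmod (if n + i < l then 0 else coeff Q (n + i - l)) \<le> b" using b b0 by auto
          ultimately show "cmod ((if n + i < l then 0 else coeff Q (n + i - l)) * (if j \<le> l then q (l - j) else 0)) \<le> b * (real n ^ d / cmod a)"
            unfolding norm_mult using b0 by (intro mult_mono) auto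
        qed
        also have "\<dots> = y" by (simp add: y_def e_def)
        finally show ?thesis .
      qed
      have P: "1\<^sub>m \<eta> + K * adj K \<in> carrier_mat \<eta> \<eta>" using car by auto
      have n1: "real n \<ge> 1" using n by simp
      have y0: "y \<ge> 0" using e0 by (simp add: y_def)
      have "cmod ((1\<^sub>m \<eta> + K * adj K) $$ (i,k)) \<le> (1 + e\<^sup>2) * real n ^ (2 * d + 3)" if ik: "i < \<eta>" "k < \<eta>" for i k
      proof -
        have "(1\<^sub>m \<eta> + K * adj K) $$ (i,k) = (if i = k then 1 else 0) + (\<Sum>j<n. K $$ (i,j) * cnj (K $$ (k,j)))"
          using ik car by (simp add: adj_def scalar_prod_def lessThan_atLeast0)
        also have "cmod \<dots> \<le> cmod (if i = k then 1 else 0) + cmod (\<Sum>j<n. K $$ (i,j) * cnj (K $$ (k,j)))"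
          by (rule norm_triangle_ineq)
        also have "\<dots> \<le> 1 + (\<Sum>j<n. y * y)"
          using Kb ik y0 by (intro add_mono order_trans[OF norm_sum sum_mono]) (auto simp: norm_mult intro!: mult_mono)
        also have "\<dots> = 1 + e\<^sup>2 * real n ^ (2 * d + 3)"
          by (simp add: y_def power2_eq_square power_add power_mult mult_ac power3_eq_cube)
        also have "\<dots> \<le> (1 + e\<^sup>2) * real n ^ (2 * d + 3)"
          using one_le_power[OF n1] by (simp add: distrib_right)
        finally show ?thesis .
      qed
      from norm_det_le[OF P this] have "x \<le> fact \<eta> * ((1 + e\<^sup>2) * real n ^ (2 * d + 3)) ^ \<eta>"
        unfolding x_def .
      also have "\<dots> = E * real n ^ s" by (simp add: E_def s_def power_mult_distrib power_mult)
      finally show ?thesis .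
    qed
    ultimately show ?thesis unfolding G_def by blast
  qed
  show ?thesis
  proof (rule that[of E s])
    fix n :: nat assume n: "n \<ge> 1"
    from main[OF n] obtain x where x: "cmod (det (mat n n (\<lambda>(i,j). coeff_inner (n + \<eta>) (Polynomial.monom 1 i * Q) (Polynomial.monom 1 j * Q)))) = x * cmod (coeff Q 0) ^ (2 * n)"
      "1 \<le> x" "x \<le> E * real n ^ s" by blast
    show "cmod (coeff Q 0) ^ (2 * n) \<le> cmod (det (mat n n (\<lambda>(i,j). coeff_inner (n + \<eta>) (Polynomial.monom 1 i * Q) (Polynomial.monom 1 j * Q))))"
      using mult_right_mono[OF x(2), of "cmod (coeff Q 0) ^ (2 * n)"] x(1) by simp
    show "cmod (det (mat n n (\<lambda>(i,j). coeff_inner (n + \<eta>) (Polynomial.monom 1 i * Q) (Polynomial.monom 1 j * Q)))) \<le> E * real n ^ s * cmod (coeff Q 0) ^ (2 * n)"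
      using mult_right_mono[OF x(3), of "cmod (coeff Q 0) ^ (2 * n)"] x(1) by simp
  qed (rule cpos)
qed

section \<open>Jensen's formula\<close>

text \<open>The mean value property: Ln (1 + r u) is holomorphic on the closed disc and vanishes at
  u = 0, and its real part is ln |1 + r u|.\<close>

lemma has_integral_ln_cmod_one_minus:
  assumes r: "cmod r < 1"
  shows "((\<lambda>\<omega>. ln (cmod (1 - r * cis \<omega>))) has_integral 0) {-pi..pi}"
proof -
  \<comment> \<open>A positive real part keeps 1 + r u away from the branch cut of
    \<open>Ln\<close>.\<close>
  have pos: "Re (1 + r * u) > 0" if "cmod u \<le> 1" for u
  proof -
    have "cmod (r * u) < 1"
      using r that mult_left_le[of "cmod u" "cmod r"] by (simp add: norm_mult)
    then show ?thesis using abs_Re_le_cmod[of "r * u"] by simp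
  qed
  have "(\<lambda>u. Ln (1 + r * u)) holomorphic_on cball 0 1"
    by (intro holomorphic_intros) (use pos in \<open>force simp: complex_nonpos_Reals_iff\<close>)
  from Cauchy_integral_circlepath_simple[OF this, of 0]
  have "((\<lambda>u. Ln (1 + r * u) / u) has_contour_integral 0) (part_circlepath 0 1 0 (2 * pi))"
    by (simp add: circlepath_def)
  then have "((\<lambda>t. \<i> * Ln (1 + r * cis t)) has_integral 0) {0..2*pi}"
    by (subst (asm) has_contour_integral_part_circlepath_iff) (auto simp: mult_ac)
  from has_integral_mult_right[OF this, of "-\<i>"]
  have "((\<lambda>t. Ln (1 + r * cis t)) has_integral 0) {0..2*pi}"
    by (simp add: mult.assoc[symmetric])
  from has_integral_linear[OF this bounded_linear_Re]
  have "((\<lambda>t. Re (Ln (1 + r * cis t))) has_integral 0) {0..2*pi}"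
    by (simp add: o_def)
  moreover have "Re (Ln (1 + r * cis t)) = ln (cmod (1 + r * cis t))" for t
    using pos[of "cis t"] by (intro Re_Ln) (metis less_irrefl norm_cis order_refl zero_complex.sel(1))
  ultimately have "((\<lambda>t. ln (cmod (1 + r * cis t))) has_integral 0) {0..2*pi}"
    by simp
  \<comment> \<open>Shifting the angle by \<pi> both moves the interval to [-\<pi>, \<pi>] and
    changes the sign in front of r.\<close>
  from has_integral_affinity'[of _ _ 0 "2*pi" 1 pi, OF this[unfolded cbox_interval[symmetric]]]
  have "((\<lambda>t. ln (cmod (1 + r * cis (t + pi)))) has_integral 0) {-pi..pi}"
    by simp
  moreover have "cis (t + pi) = - cis t" for t by (simp add: cis_mult[symmetric])
  ultimately show ?thesis by simp
qed

lemma has_bochner_integral_ln_cmod_one_minus: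
  assumes r: "cmod r < 1"
  shows "has_bochner_integral lborel (\<lambda>\<omega>. indicator {-pi..pi} \<omega> * ln (cmod (1 - r * cis \<omega>))) 0"
proof -
  have nz: "1 - r * cis \<omega> \<noteq> 0" for \<omega>
  proof
    assume "1 - r * cis \<omega> = 0"
    then have "cmod (r * cis \<omega>) = 1" by (metis eq_iff_diff_eq_0 norm_one)
    with r show False by (simp add: norm_mult)
  qed
  have int: "set_integrable lborel {-pi..pi} (\<lambda>\<omega>. ln (cmod (1 - r * cis \<omega>)))"
    by (intro borel_integrable_atLeastAtMost' continuous_intros) (use nz in auto)
  have "(LBINT \<omega>:{-pi..pi}. ln (cmod (1 - r * cis \<omega>))) = 0"
    using set_borel_integral_eq_integral(2)[OF int] has_integral_ln_cmod_one_minus[OF r]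
    by (simp add: integral_unique)
  with int show ?thesis
    by (simp add: has_bochner_integral_iff set_integrable_def set_lebesgue_integral_def)
qed

text \<open>The exceptional angles lie in one coset of 2 \<pi> Z, a countable set. This discards the
  angles at which a logarithm is singular.\<close>

lemma AE_cis_neq: "AE \<omega> in lborel. cis \<omega> \<noteq> w"
proof (cases "\<exists>a. cis a = w")
  case True
  then obtain a where a: "cis a = w" ..
  have "{\<omega>. cis \<omega> = w} \<subseteq> range (\<lambda>n::int. a + 2 * pi * of_int n)"
  proof
    fix \<omega> assume "\<omega> \<in> {\<omega>. cis \<omega> = w}"
    then have "sin \<omega> = sin a \<and> cos \<omega> = cos a" using a by (metis cis.sel mem_Collect_eq)
    then show "\<omega> \<in> range (\<lambda>n::int. a + 2 * pi * of_int n)" by (auto simp: sin_cos_eq_iff)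
  qed
  then have "countable {\<omega>. cis \<omega> = w}" by (rule countable_subset) auto
  then have "{\<omega>. cis \<omega> = w} \<in> null_sets lborel" by (rule countable_imp_null_set_lborel)
  from AE_not_in[OF this] show ?thesis by auto
qed auto

text \<open>The functions ln (1 + \<rho>) - ln |1 - \<rho> \<zeta>| with |\<zeta>| = 1 increase with \<rho> < 1, so that the case
  |z| = 1 is the monotone limit of the case |z| < 1.\<close>

lemma cmod_one_minus_scaled_le:
  assumes "cmod \<zeta> = 1" "0 \<le> \<rho>" "\<rho> \<le> \<sigma>" "\<sigma> \<le> 1"
  shows "cmod (1 - of_real \<sigma> * \<zeta>) * (1 + \<rho>) \<le> cmod (1 - of_real \<rho> * \<zeta>) * (1 + \<sigma>)"
proof (rule power2_le_imp_le)
  define c where "c = Re \<zeta>"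
  have c: "(Im \<zeta>)\<^sup>2 = 1 - c\<^sup>2" and c1: "-1 \<le> c"
    using assms(1) abs_Re_le_cmod[of \<zeta>] cmod_power2[of \<zeta>] by (auto simp: c_def)
  have sq: "(cmod (1 - of_real s * \<zeta>))\<^sup>2 = 1 - 2 * s * c + s\<^sup>2" for s
  proof -
    have "(cmod (1 - of_real s * \<zeta>))\<^sup>2 = (1 - s * c)\<^sup>2 + s\<^sup>2 * (Im \<zeta>)\<^sup>2"
      by (simp add: cmod_power2 c_def power_mult_distrib)
    then show ?thesis unfolding c by (simp add: power2_eq_square algebra_simps)
  qed
  \<comment> \<open>The difference of the squared sides is a polynomial in c, \<rho>, \<sigma> that
    factors completely into nonnegative terms.\<close>
  have "0 \<le> 2 * (1 + c) * (\<sigma> - \<rho>) * (1 - \<rho> * \<sigma>)"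
    using assms c1 mult_le_one[of \<rho> \<sigma>] by (intro mult_nonneg_nonneg) auto
  also have "\<dots> = (1 - 2 * \<rho> * c + \<rho>\<^sup>2) * (1 + \<sigma>)\<^sup>2 - (1 - 2 * \<sigma> * c + \<sigma>\<^sup>2) * (1 + \<rho>)\<^sup>2"
    by (simp add: power2_eq_square algebra_simps)
  finally show "(cmod (1 - of_real \<sigma> * \<zeta>) * (1 + \<rho>))\<^sup>2 \<le> (cmod (1 - of_real \<rho> * \<zeta>) * (1 + \<sigma>))\<^sup>2"
    unfolding power_mult_distrib sq by simp
qed (use assms in auto)

lemma has_bochner_integral_ln_cmod_one_minus_unit:
  assumes z: "cmod z = 1"
  shows "has_bochner_integral lborel (\<lambda>\<omega>. indicator {-pi..pi} \<omega> * ln (cmod (1 - z * cis \<omega>))) 0"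
proof -
  let ?I = "\<lambda>\<omega>. indicator {-pi..pi} \<omega> :: real"
  \<comment> \<open>A sequence in [0, 1) increasing to 1, so that z is approached radially from
    inside the disc.\<close>
  define \<rho> where "\<rho> k = real k / (real k + 1)" for k
  have \<rho>: "0 \<le> \<rho> k" "\<rho> k < 1" for k by (auto simp: \<rho>_def)
  have \<rho>_mono: "\<rho> k \<le> \<rho> l" if "k \<le> l" for k l
    using that by (auto simp: \<rho>_def field_simps)
  have \<rho>_lim: "\<rho> \<longlonglongrightarrow> 1" unfolding \<rho>_def by real_asymp
  \<comment> \<open>The term ln (1 + \<rho> k) makes f increasing in k. Since the other term
    integrates to 0, it alone determines the integral of f.\<close>
  define f where "f k \<omega> = ?I \<omega> * ln (1 + \<rho> k) - ?I \<omega> * ln (cmod (1 - of_real (\<rho> k) * z * cis \<omega>))" for k \<omega>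
  define F where "F \<omega> = ?I \<omega> * ln 2 - ?I \<omega> * ln (cmod (1 - z * cis \<omega>))" for \<omega>
  have const: "has_bochner_integral lborel (\<lambda>\<omega>. ?I \<omega> * c) (2 * pi * c)" for c
  proof -
    have "has_bochner_integral lborel ?I (measure lborel {-pi..pi})"
      by (intro has_bochner_integral_real_indicator) auto
    then show ?thesis by (intro has_bochner_integral_mult_left) auto
  qed
  have hf: "has_bochner_integral lborel (f k) (2 * pi * ln (1 + \<rho> k))" for k
  proof -
    have "cmod (of_real (\<rho> k) * z) < 1" using \<rho>[of k] z by (simp add: norm_mult)
    from has_bochner_integral_diff[OF const has_bochner_integral_ln_cmod_one_minus[OF this], of "ln (1 + \<rho> k)"]
    show ?thesis by (simp add: f_def[abs_def])
  qed
  have nz: "cmod (1 - of_real (\<rho> k) * z * cis \<omega>) > 0" for k \<omega>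
  proof -
    have "1 - of_real (\<rho> k) * z * cis \<omega> \<noteq> 0"
    proof
      assume "1 - of_real (\<rho> k) * z * cis \<omega> = 0"
      then have "cmod (of_real (\<rho> k) * z * cis \<omega>) = 1" by (metis eq_iff_diff_eq_0 norm_one)
      with \<rho>[of k] z show False by (simp add: norm_mult)
    qed
    then show ?thesis by simp
  qed
  have mono: "f k \<omega> \<le> f l \<omega>" if "k \<le> l" for k l \<omega>
  proof -
    have "cmod (1 - of_real (\<rho> l) * z * cis \<omega>) * (1 + \<rho> k) \<le> cmod (1 - of_real (\<rho> k) * z * cis \<omega>) * (1 + \<rho> l)"
      using cmod_one_minus_scaled_le[of "z * cis \<omega>" "\<rho> k" "\<rho> l"] \<rho>[of k] \<rho>[of l] \<rho>_mono[OF that] z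
      by (simp add: norm_mult mult.assoc)
    then have "ln (cmod (1 - of_real (\<rho> l) * z * cis \<omega>) * (1 + \<rho> k)) \<le> ln (cmod (1 - of_real (\<rho> k) * z * cis \<omega>) * (1 + \<rho> l))"
      using nz[of k \<omega>] nz[of l \<omega>] \<rho>[of k] \<rho>[of l] by (subst ln_le_cancel_iff) (auto intro!: mult_pos_pos add_pos_nonneg)
    then have "ln (1 + \<rho> k) - ln (cmod (1 - of_real (\<rho> k) * z * cis \<omega>)) \<le> ln (1 + \<rho> l) - ln (cmod (1 - of_real (\<rho> l) * z * cis \<omega>))"
      using nz[of k \<omega>] nz[of l \<omega>] \<rho>[of k] \<rho>[of l] by (subst (asm) (1 2) ln_mult_pos) auto
    then show ?thesis by (simp add: f_def indicator_def)
  qed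
  \<comment> \<open>Convergence can fail only where z cis \<omega> = 1, the logarithmic singularity,
    which is a null set.\<close>
  have lim: "AE \<omega> in lborel. (\<lambda>k. f k \<omega>) \<longlonglongrightarrow> F \<omega>"
    using AE_cis_neq[of "inverse z"]
  proof (eventually_elim)
    case (elim \<omega>)
    then have "1 - z * cis \<omega> \<noteq> 0" by (metis eq_iff_diff_eq_0 inverse_unique)
    moreover have "(\<lambda>k. cmod (1 - of_real (\<rho> k) * z * cis \<omega>)) \<longlonglongrightarrow> cmod (1 - of_real 1 * z * cis \<omega>)"
      by (intro tendsto_intros \<rho>_lim)
    ultimately have "(\<lambda>k. ln (cmod (1 - of_real (\<rho> k) * z * cis \<omega>))) \<longlonglongrightarrow> ln (cmod (1 - z * cis \<omega>))"
      by (intro tendsto_ln) auto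
    moreover have "(\<lambda>k. ln (1 + \<rho> k)) \<longlonglongrightarrow> ln (1 + 1)"
      by (intro tendsto_ln tendsto_add tendsto_const \<rho>_lim) auto
    ultimately have "(\<lambda>k. f k \<omega>) \<longlonglongrightarrow> ?I \<omega> * ln (1 + 1) - ?I \<omega> * ln (cmod (1 - z * cis \<omega>))"
      unfolding f_def by (intro tendsto_diff tendsto_mult tendsto_const)
    then show ?case by (simp add: F_def)
  qed
  have F: "has_bochner_integral lborel F (2 * pi * ln (1 + 1))"
  proof (rule has_bochner_integral_monotone_convergence)
    show "integrable lborel (f k)" for k using hf[of k] by (simp add: has_bochner_integral_iff)
    show "AE x in lborel. mono (\<lambda>n. f n x)" using mono by (auto simp: mono_def)
    show "AE x in lborel. (\<lambda>i. f i x) \<longlonglongrightarrow> F x" by (rule lim)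
    have "(\<lambda>k. 2 * pi * ln (1 + \<rho> k)) \<longlonglongrightarrow> 2 * pi * ln (1 + 1)"
      by (intro tendsto_intros \<rho>_lim) auto
    then show "(\<lambda>k. integral\<^sup>L lborel (f k)) \<longlonglongrightarrow> 2 * pi * ln (1 + 1)"
      using hf by (simp add: has_bochner_integral_iff)
    have [measurable]: "(\<lambda>\<omega>. cmod (1 - z * cis \<omega>)) \<in> borel_measurable borel"
      by (intro borel_measurable_continuous_onI continuous_intros)
    show "F \<in> borel_measurable lborel" unfolding F_def[abs_def] by measurable
  qed
  \<comment> \<open>The limit F integrates to 2 \<pi> ln 2, exactly the integral of its constant
    part, so the logarithm itself integrates to 0.\<close>
  from has_bochner_integral_diff[OF const[of "ln 2"] F] show ?thesis by (simp add: F_def)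
qed

text \<open>Jensen's formula for one linear factor, written in cis (-\<omega>) because the frequency
  response is a polynomial in it. Multiplying by cis \<omega> reduces |z| <= 1 to the previous
  cases.\<close>

lemma has_bochner_integral_ln_cmod_linear:
  "has_bochner_integral lborel (\<lambda>\<omega>. indicator {-pi..pi} \<omega> * ln (cmod (cis (-\<omega>) - z)))
     (2 * pi * ln (max 1 (cmod z)))"
proof -
  have eq: "cmod (cis (-\<omega>) - z) = cmod (1 - z * cis \<omega>)" for \<omega>
  proof -
    have "cmod (1 - z * cis \<omega>) = cmod ((cis (-\<omega>) - z) * cis \<omega>)" by (simp add: left_diff_distrib cis_mult)
    then show ?thesis by (simp add: norm_mult)
  qed
  consider "cmod z < 1" | "cmod z = 1" | "cmod z > 1" by linarith
  then show ?thesis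
  proof cases
    case 1
    with has_bochner_integral_ln_cmod_one_minus[OF 1] show ?thesis by (simp add: eq max_def)
  next
    case 2
    with has_bochner_integral_ln_cmod_one_minus_unit[OF 2] show ?thesis by (simp add: eq)
  next
    case 3
    \<comment> \<open>For |z| > 1 the factor is -z times the conjugate of 1 - r cis \<omega>, with r
      inside the disc; the constant part contributes ln |z|.\<close>
    define r where "r = cnj (inverse z)"
    have r: "cmod r < 1" using 3 by (simp add: r_def norm_inverse inverse_less_1_iff)
    have nz: "1 - r * cis \<omega> \<noteq> 0" for \<omega>
    proof
      assume "1 - r * cis \<omega> = 0"
      then have "cmod (r * cis \<omega>) = 1" by (metis eq_iff_diff_eq_0 norm_one)
      with r show False by (simp add: norm_mult)
    qed
    have eq': "ln (cmod (cis (-\<omega>) - z)) = ln (cmod z) + ln (cmod (1 - r * cis \<omega>))" for \<omega>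
    proof -
      have "z * inverse z = 1" using 3 by (intro right_inverse) auto
      then have "cis (-\<omega>) - z = - z * cnj (1 - r * cis \<omega>)"
        by (auto simp: r_def algebra_simps cis_cnj)
      then have "cmod (cis (-\<omega>) - z) = cmod z * cmod (1 - r * cis \<omega>)"
        by (simp only: norm_mult norm_minus_cancel complex_mod_cnj)
      moreover have "cmod z > 0" using 3 by linarith
      ultimately show ?thesis using nz[of \<omega>] by (simp add: ln_mult_pos)
    qed
    have "has_bochner_integral lborel (\<lambda>\<omega>. indicator {-pi..pi} \<omega> :: real) (measure lborel {-pi..pi})"
      by (intro has_bochner_integral_real_indicator) auto
    then have "has_bochner_integral lborel (\<lambda>\<omega>. indicator {-pi..pi} \<omega> * ln (cmod z)) (2 * pi * ln (cmod z))"
      by (intro has_bochner_integral_mult_left) auto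
    from has_bochner_integral_add[OF this has_bochner_integral_ln_cmod_one_minus[OF r]]
    show ?thesis using 3 by (simp add: eq' distrib_left max_def)
  qed
qed

lemma interval_integral_ln_cmod_prod:
  fixes a :: complex
  assumes a: "a \<noteq> 0" and h: "\<And>\<omega>. h \<omega> = a * (\<Prod>z\<leftarrow>as. cis (-\<omega>) - z)"
  shows "(LBINT \<omega>=-pi..pi. ln (cmod (h \<omega>))) = 2 * pi * (ln (cmod a) + (\<Sum>z\<leftarrow>as. ln (max 1 (cmod z))))"
proof -
  let ?I = "\<lambda>\<omega>. indicator {-pi..pi} \<omega> :: real"
  have sum: "has_bochner_integral lborel (\<lambda>\<omega>. ?I \<omega> * (ln (cmod a) + (\<Sum>z\<leftarrow>as. ln (cmod (cis (-\<omega>) - z)))))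
     (2 * pi * (ln (cmod a) + (\<Sum>z\<leftarrow>as. ln (max 1 (cmod z)))))"
  proof (induction as)
    case Nil
    have "has_bochner_integral lborel ?I (measure lborel {-pi..pi})"
      by (intro has_bochner_integral_real_indicator) auto
    then have "has_bochner_integral lborel (\<lambda>\<omega>. ?I \<omega> * ln (cmod a)) (2 * pi * ln (cmod a))"
      by (intro has_bochner_integral_mult_left) auto
    then show ?case by simp
  next
    case (Cons z as)
    from has_bochner_integral_add[OF has_bochner_integral_ln_cmod_linear[of z] Cons]
    show ?case by (simp add: algebra_simps)
  qed
  \<comment> \<open>Off this null set no factor vanishes, as cis \<omega> = cnj z means cis
    (-\<omega>) = z. At a zero, where \<open>ln 0 = 0\<close>, splitting the logarithm of the
    product may fail.\<close>
  have "AE \<omega> in lborel. \<forall>z\<in>set as. cis \<omega> \<noteq> cnj z"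
    using AE_cis_neq by (subst AE_finite_all) auto
  then have "AE \<omega> in lborel. ?I \<omega> * (ln (cmod a) + (\<Sum>z\<leftarrow>as. ln (cmod (cis (-\<omega>) - z)))) = ?I \<omega> * ln (cmod (h \<omega>))"
  proof eventually_elim
    case (elim \<omega>)
    have "\<forall>z\<in>set as. cis (-\<omega>) - z \<noteq> 0"
      using elim by (metis cis_cnj complex_cnj_cnj eq_iff_diff_eq_0)
    then have "(\<Prod>z\<leftarrow>as. cis (-\<omega>) - z) \<noteq> 0 \<and> ln (cmod (\<Prod>z\<leftarrow>as. cis (-\<omega>) - z)) = (\<Sum>z\<leftarrow>as. ln (cmod (cis (-\<omega>) - z)))"
      by (induction as) (auto simp: norm_mult ln_mult_pos)
    with a show ?case by (simp add: h norm_mult ln_mult_pos)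
  qed
  moreover have meas: "(\<lambda>\<omega>. ?I \<omega> * ln (cmod (h \<omega>))) \<in> borel_measurable lborel"
  proof -
    have "continuous_on UNIV (\<lambda>\<omega>. \<Prod>z\<leftarrow>as. cis (-\<omega>) - z)"
      by (induction as) (auto intro!: continuous_intros)
    then have "(\<lambda>\<omega>. \<Prod>z\<leftarrow>as. cis (-\<omega>) - z) \<in> borel_measurable borel"
      by (rule borel_measurable_continuous_onI)
    then show ?thesis unfolding h by measurable
  qed
  ultimately have "has_bochner_integral lborel (\<lambda>\<omega>. ?I \<omega> * ln (cmod (h \<omega>)))
     (2 * pi * (ln (cmod a) + (\<Sum>z\<leftarrow>as. ln (max 1 (cmod z)))))"
    using sum by (subst has_bochner_integral_cong_AE[symmetric]) (auto simp: has_bochner_integral_iff)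
  moreover have "(LBINT \<omega>=-pi..pi. ln (cmod (h \<omega>))) = (LBINT \<omega>:{-pi..pi}. ln (cmod (h \<omega>)))"
    using interval_integral_Icc[of "-pi" pi "\<lambda>\<omega>. ln (cmod (h \<omega>))"] by simp
  ultimately show ?thesis by (simp add: has_bochner_integral_iff set_lebesgue_integral_def)
qed

section \<open>Entropy gain of the filter\<close>

lemma coeff_inner_smult:
  "coeff_inner N (Polynomial.smult a f) (Polynomial.smult a h) = cnj a * a * coeff_inner N f h"
  by (simp add: coeff_inner_def sum_distrib_left mult_ac)

text \<open>The Gram determinant is the squared product of the diagonal of T for every thin SVD, so
  the value does not depend on the factor A that the choice operator picks. D \<noteq> 0 gives full
  column rank, hence an SVD, and makes every diagonal entry nonzero.\<close>

lemma eff_entropy_eq: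
  assumes M: "prob_space M" and fin: "finite_diff_entropy M n X"
    and D: "D = det (mat n n (\<lambda>(i,j). \<Sum>k<l. S k i * S k j))" and D0: "D \<noteq> 0"
  shows "eff_entropy M l n S (\<lambda>\<omega>. mat_vec l n S (X \<omega>)) = diff_entropy M n X + ln \<bar>D\<bar> / 2"
proof -
  let ?G = "mat n n (\<lambda>(i,j). \<Sum>k<l. S k i * S k j)"
  have rank: "full_column_rank l n S"
    unfolding full_column_rank_def
  proof (intro allI impI)
    fix x :: "nat \<Rightarrow> real" and j
    assume S0: "\<forall>i<l. (\<Sum>j<n. S i j * x j) = 0" and j: "j < n"
    \<comment> \<open>The kernel of S lies in the kernel of its Gram matrix, which is trivial as D
      \<noteq> 0.\<close>
    have "?G *\<^sub>v vec n x = 0\<^sub>v n"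
    proof (rule eq_vecI)
      fix i assume "i < dim_vec (0\<^sub>v n :: real vec)"
      then have i: "i < n" by simp
      have "(?G *\<^sub>v vec n x) $ i = (\<Sum>j<n. \<Sum>k<l. S k i * (S k j * x j))"
        using i by (simp add: scalar_prod_def lessThan_atLeast0 sum_distrib_right mult.assoc)
      also have "\<dots> = (\<Sum>k<l. S k i * (\<Sum>j<n. S k j * x j))"
        by (subst sum.swap) (simp add: sum_distrib_left)
      also have "\<dots> = 0" using S0 by simp
      finally show "(?G *\<^sub>v vec n x) $ i = 0\<^sub>v n $ i" using i by simp
    qed simp
    moreover have "?G \<in> carrier_mat n n" by simp
    ultimately have "vec n x = 0\<^sub>v n"
      using D0 D det_0_iff_vec_prod_zero_field[of ?G n] vec_carrier[of n x] by blast
    then show "x j = 0" using j by (metis index_vec index_zero_vec(1))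
  qed
  define A where "A = (SOME A. \<exists>T C. thin_svd l n S A T C)"
  have "\<exists>T C. thin_svd l n S A T C"
    unfolding A_def using thin_svd_exists[OF rank] by (rule someI_ex)
  then obtain T C where svd: "thin_svd l n S A T C" by blast
  have A: "orthonormal_rows n l A" and C: "orthonormal_rows n n C"
    and Tdiag: "\<And>i j. i < n \<Longrightarrow> j < n \<Longrightarrow> i \<noteq> j \<Longrightarrow> T i j = 0"
    using svd by (auto simp: thin_svd_def)
  define t where "t i = T i i" for i
  have S: "S k j = (\<Sum>m<n. A m k * (t m * C m j))" if "k < l" "j < n" for k j
  proof -
    have "S k j = (\<Sum>m<n. (\<Sum>p<n. A p k * T p m) * C m j)"
      using svd that by (simp add: thin_svd_def mat_mult_def Defs.transpose_mat_def)
    also have "\<dots> = (\<Sum>m<n. (\<Sum>p<n. if p = m then A m k * t m else 0) * C m j)"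
      using Tdiag by (intro sum.cong arg_cong2[where f="(*)"] refl) (auto simp: t_def)
    also have "\<dots> = (\<Sum>m<n. A m k * (t m * C m j))"
      by (intro sum.cong) auto
    finally show ?thesis .
  qed
  \<comment> \<open>The rows of A are orthonormal, so A S = T C: the reduced output A y is diag(t) C
    applied to X.\<close>
  have AS: "(\<Sum>k<l. A i k * S k j) = t i * C i j" if ij: "i < n" "j < n" for i j
  proof -
    have "(\<Sum>k<l. A i k * S k j) = (\<Sum>k<l. \<Sum>m<n. A i k * A m k * (t m * C m j))"
      using ij by (intro sum.cong) (auto simp: S sum_distrib_left mult.assoc)
    also have "\<dots> = (\<Sum>m<n. (\<Sum>k<l. A i k * A m k) * (t m * C m j))"
      by (subst sum.swap) (simp add: sum_distrib_right)
    also have "\<dots> = (\<Sum>m<n. if i = m then t m * C m j else 0)"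
      using A ij by (intro sum.cong) (auto simp: orthonormal_rows_def)
    also have "\<dots> = t i * C i j" using ij by simp
    finally show ?thesis .
  qed
  let ?B = "mat n n (\<lambda>(i,j). t i * C i j)" and ?C = "mat n n (\<lambda>(i,j). C i j)"
  have Gram: "?G = transpose_mat ?B * ?B"
  proof (rule eq_matI)
    fix i j assume "i < dim_row (transpose_mat ?B * ?B)" "j < dim_col (transpose_mat ?B * ?B)"
    then have ij: "i < n" "j < n" by auto
    have "(\<Sum>k<l. S k i * S k j) = (\<Sum>k<l. \<Sum>m<n. (t m * C m i) * (A m k * S k j))"
      using ij by (intro sum.cong) (auto simp: S[of _ i] sum_distrib_left sum_distrib_right mult_ac)
    also have "\<dots> = (\<Sum>m<n. (t m * C m i) * (\<Sum>k<l. A m k * S k j))"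
      by (subst sum.swap) (simp add: sum_distrib_left)
    also have "\<dots> = (\<Sum>m<n. (t m * C m i) * (t m * C m j))"
      using ij by (intro sum.cong) (auto simp: AS)
    finally show "?G $$ (i,j) = (transpose_mat ?B * ?B) $$ (i,j)"
      using ij by (simp add: scalar_prod_def lessThan_atLeast0)
  qed auto
  have "?B = mat n n (\<lambda>(i,j). if i = j then t i else 0) * ?C" (is "_ = ?T * _")
  proof (rule eq_matI)
    fix i j assume "i < dim_row (?T * ?C)" "j < dim_col (?T * ?C)"
    then have ij: "i < n" "j < n" by auto
    have "(?T * ?C) $$ (i,j) = (\<Sum>k<n. (if i = k then t i else 0) * C k j)"
      using ij by (simp add: scalar_prod_def lessThan_atLeast0)
    also have "\<dots> = (\<Sum>k<n. if i = k then t i * C k j else 0)" by (intro sum.cong) auto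
    finally show "?B $$ (i,j) = (?T * ?C) $$ (i,j)" using ij by simp
  qed auto
  then have "det ?B = det ?T * det ?C" by (simp add: det_mult[of _ n])
  also have "det ?T = (\<Prod>i<n. t i)"
    by (subst det_upper_triangular[of _ n])
       (auto simp: diag_mat_def prod.list_conv_set_nth lessThan_atLeast0)
  finally have detB: "det ?B = (\<Prod>i<n. t i) * det ?C" .
  have "?C * transpose_mat ?C = 1\<^sub>m n"
    using C by (intro eq_matI) (auto simp: orthonormal_rows_def scalar_prod_def lessThan_atLeast0)
  then have "det ?C * det ?C = 1"
    using det_mult[of ?C n "transpose_mat ?C"] det_transpose[of ?C n] by simp
  moreover have "D = det ?B * det ?B"
    unfolding D Gram using det_mult[of "transpose_mat ?B" n ?B] det_transpose[of ?B n] by simp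
  ultimately have D_eq: "D = (\<Prod>i<n. t i)\<^sup>2"
    unfolding detB by (simp add: power2_eq_square mult_ac)
  have t0: "t i \<noteq> 0" if "i < n" for i
    using D0 that unfolding D_eq by auto
  \<comment> \<open>\<open>thin_svd\<close> permits negative diagonal entries, hence the absolute
    values.\<close>
  have "\<bar>D\<bar> = (\<Prod>i<n. \<bar>t i\<bar>)\<^sup>2" by (simp add: D_eq abs_prod[symmetric])
  then have "ln \<bar>D\<bar> = 2 * ln (\<Prod>i<n. \<bar>t i\<bar>)"
    using t0 by (simp add: ln_realpow prod_pos)
  also have "ln (\<Prod>i<n. \<bar>t i\<bar>) = (\<Sum>i<n. ln \<bar>t i\<bar>)"
    using t0 by (intro ln_prod) auto
  finally have lnD: "(\<Sum>i<n. ln \<bar>t i\<bar>) = ln \<bar>D\<bar> / 2" by simp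
  have "eff_entropy M l n S (\<lambda>\<omega>. mat_vec l n S (X \<omega>)) =
      diff_entropy M n (\<lambda>\<omega>. mat_vec n n (mat_mult l A S) (X \<omega>))"
    by (simp add: eff_entropy_def Let_def A_def mat_vec_mat_vec)
  also have "\<dots> = diff_entropy M n X + (\<Sum>i<n. ln \<bar>t i\<bar>)"
    using AS by (intro diff_entropy_mat_vec[OF M fin C t0]) (auto simp: mat_mult_def)
  finally show ?thesis by (simp add: lnD)
qed

theorem mainTheorem14:
  fixes M :: "'a measure" and u :: "nat \<Rightarrow> 'a \<Rightarrow> real"
    and g :: "nat \<Rightarrow> real" and \<eta> :: nat
  assumes "prob_space M"
    and "\<And>k. u k \<in> borel_measurable M"
    and "entropy_balanced M u"
    and "\<And>n. finite_diff_entropy M n (proc_vec n u)"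
    and "\<exists>k\<le>\<eta>. g k \<noteq> 0"
  shows "(\<lambda>n. (eff_entropy M (n + \<eta>) n (conv_mat g \<eta>)
                  (\<lambda>\<omega>. mat_vec (n + \<eta>) n (conv_mat g \<eta>) (proc_vec n u \<omega>))
                - diff_entropy M n (proc_vec n u)) / real n)
         \<longlonglongrightarrow> (1 / (2 * pi)) * (LBINT \<omega>=-pi..pi. ln (cmod (freq_resp g \<eta> \<omega>)))"
proof -
  \<comment> \<open>The transfer function as a polynomial in 1 / z; on the unit circle its argument
    is cis (-\<omega>).\<close>
  define p where "p = (\<Sum>k\<le>\<eta>. Polynomial.monom (complex_of_real (g k)) k)"
  have coeff_p: "coeff p k = (if k \<le> \<eta> then complex_of_real (g k) else 0)" for k
  proof -
    have "coeff p k = (\<Sum>i\<le>\<eta>. if i = k then complex_of_real (g i) else 0)"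
      by (simp add: p_def coeff_sum)
    then show ?thesis by simp
  qed
  have p0: "p \<noteq> 0" using assms(5) coeff_p by (metis coeff_0 of_real_eq_0_iff)
  have deg_p: "degree p \<le> \<eta>" by (rule degree_le) (simp add: coeff_p)
  define a where "a = lead_coeff p"
  have a0: "a \<noteq> 0" using p0 by (simp add: a_def)
  obtain as where as: "Polynomial.smult a (\<Prod>z\<leftarrow>as. [:- z, 1:]) = p" "length as = degree p"
    using fundamental_theorem_algebra_factorized[of p] unfolding a_def by blast
  \<comment> \<open>Reflection keeps the Gram matrix of the shifts of p and removes all roots from
    the open disc, so that 1 / Q has polynomially bounded coefficients.\<close>
  define Q where "Q = Polynomial.smult a (\<Prod>z\<leftarrow>as. reflect_factor z)"
  define c where "c = cmod (coeff Q 0)"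
  define D where "D n = det (mat n n (\<lambda>(i,j). \<Sum>k<n+\<eta>. conv_mat g \<eta> k i * conv_mat g \<eta> k j))" for n
  have D_eq: "complex_of_real (D n) = det (mat n n (\<lambda>(i,j). coeff_inner (n + \<eta>) (Polynomial.monom 1 i * Q) (Polynomial.monom 1 j * Q)))" for n
  proof -
    let ?m = "\<lambda>i. Polynomial.monom (1::complex) i"
    have cm: "complex_of_real (conv_mat g \<eta> k i) = coeff (?m i * p) k" for k i
      by (auto simp: conv_mat_def coeff_monom_mult coeff_p)
    have ip: "coeff_inner (n + \<eta>) (?m i * p) (?m j * p) = coeff_inner (n + \<eta>) (?m i * Q) (?m j * Q)" if "i < n" "j < n" for i j
    proof -
      have "coeff_inner (n + \<eta>) (?m i * p) (?m j * p) = cnj a * a *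
          coeff_inner (n + \<eta>) ((\<Prod>z\<leftarrow>as. [:- z, 1:]) * ?m i) ((\<Prod>z\<leftarrow>as. [:- z, 1:]) * ?m j)"
        unfolding as(1)[symmetric] by (simp add: coeff_inner_smult mult.commute)
      \<comment> \<open>The degree condition holds because a shift is at most n - 1 and p has at
        most \<eta> roots.\<close>
      also have "coeff_inner (n + \<eta>) ((\<Prod>z\<leftarrow>as. [:- z, 1:]) * ?m i) ((\<Prod>z\<leftarrow>as. [:- z, 1:]) * ?m j) =
          coeff_inner (n + \<eta>) ((\<Prod>z\<leftarrow>as. reflect_factor z) * ?m i) ((\<Prod>z\<leftarrow>as. reflect_factor z) * ?m j)"
        using that deg_p as(2) by (intro coeff_inner_reflect_prod) (auto simp: degree_monom_eq)
      finally show ?thesis unfolding Q_def by (simp add: coeff_inner_smult mult.commute)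
    qed
    have "complex_of_real (D n) = det (map_mat complex_of_real (mat n n (\<lambda>(i,j). \<Sum>k<n+\<eta>. conv_mat g \<eta> k i * conv_mat g \<eta> k j)))"
      unfolding D_def by (rule of_real_hom.hom_det[symmetric])
    also have "map_mat complex_of_real (mat n n (\<lambda>(i,j). \<Sum>k<n+\<eta>. conv_mat g \<eta> k i * conv_mat g \<eta> k j))
        = mat n n (\<lambda>(i,j). coeff_inner (n + \<eta>) (?m i * Q) (?m j * Q))"
    proof (rule eq_matI)
      fix i j assume "i < dim_row (mat n n (\<lambda>(i,j). coeff_inner (n + \<eta>) (?m i * Q) (?m j * Q)))"
        "j < dim_col (mat n n (\<lambda>(i,j). coeff_inner (n + \<eta>) (?m i * Q) (?m j * Q)))"
      then have ij: "i < n" "j < n" by auto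
      have "complex_of_real (\<Sum>k<n+\<eta>. conv_mat g \<eta> k i * conv_mat g \<eta> k j) = coeff_inner (n + \<eta>) (?m i * p) (?m j * p)"
        unfolding coeff_inner_def cm[symmetric] by simp
      with ij show "map_mat complex_of_real (mat n n (\<lambda>(i,j). \<Sum>k<n+\<eta>. conv_mat g \<eta> k i * conv_mat g \<eta> k j)) $$ (i,j)
        = mat n n (\<lambda>(i,j). coeff_inner (n + \<eta>) (?m i * Q) (?m j * Q)) $$ (i,j)"
        by (simp add: ip)
    qed auto
    finally show ?thesis .
  qed
  obtain E s where bounds: "\<And>n. n \<ge> 1 \<Longrightarrow>
      cmod (coeff Q 0) ^ (2 * n) \<le> cmod (det (mat n n (\<lambda>(i,j). coeff_inner (n + \<eta>) (Polynomial.monom 1 i * Q) (Polynomial.monom 1 j * Q))))"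
    "\<And>n. n \<ge> 1 \<Longrightarrow> cmod (det (mat n n (\<lambda>(i,j). coeff_inner (n + \<eta>) (Polynomial.monom 1 i * Q) (Polynomial.monom 1 j * Q))))
        \<le> E * real n ^ s * cmod (coeff Q 0) ^ (2 * n)"
    "cmod (coeff Q 0) > 0"
    by (rule gram_det_bounds[OF Q_def a0, of \<eta>]) blast
  have lower: "c ^ (2 * n) \<le> \<bar>D n\<bar>" and upper: "\<bar>D n\<bar> \<le> E * real n ^ s * c ^ (2 * n)" if "n \<ge> 1" for n
    using bounds(1,2)[OF that] by (simp_all only: D_eq[symmetric] norm_of_real c_def)
  have c0: "c > 0" using bounds(3) by (simp only: c_def)
  have ratio: "(eff_entropy M (n + \<eta>) n (conv_mat g \<eta>)
        (\<lambda>\<omega>. mat_vec (n + \<eta>) n (conv_mat g \<eta>) (proc_vec n u \<omega>)) - diff_entropy M n (proc_vec n u)) / real n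
      = ln \<bar>D n\<bar> / (2 * real n)" if n: "n \<ge> 1" for n
  proof -
    \<comment> \<open>The lower bound on the Gram determinant makes it nonzero, which
      \<open>eff_entropy_eq\<close> requires.\<close>
    have "c ^ (2 * n) > 0" using c0 by simp
    with lower[OF n] have "D n \<noteq> 0" by auto
    from eff_entropy_eq[OF assms(1,4) D_def[of n] this] show ?thesis by simp
  qed
  have E0: "E > 0"
  proof -
    \<comment> \<open>Comparing both bounds at n = 1 shows E > 0, so that \<open>ln E\<close> splits
      off below.\<close>
    have "c ^ (2 * 1) \<le> E * real 1 ^ s * c ^ (2 * 1)" using lower[of 1] upper[of 1] by simp
    moreover have "c ^ (2 * 1) > 0" using c0 by simp
    ultimately have "0 < E * c ^ (2 * 1)" by simp
    then show ?thesis using c0 by (simp add: zero_less_mult_iff)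
  qed
  have "(\<lambda>n. ln \<bar>D n\<bar> / (2 * real n)) \<longlonglongrightarrow> ln c"
  proof (rule tendsto_sandwich)
    show "\<forall>\<^sub>F n in sequentially. ln c \<le> ln \<bar>D n\<bar> / (2 * real n)"
    proof (rule eventually_sequentiallyI)
      fix n :: nat assume n: "n \<ge> 1"
      have "ln (c ^ (2 * n)) \<le> ln \<bar>D n\<bar>"
        using lower[OF n] c0 by (intro ln_mono) auto
      with n c0 show "ln c \<le> ln \<bar>D n\<bar> / (2 * real n)"
        by (simp add: ln_realpow field_simps)
    qed
    \<comment> \<open>The polynomial factor E n^s adds only (ln E + s ln n) / (2 n), which tends to
      0.\<close>
    show "\<forall>\<^sub>F n in sequentially. ln \<bar>D n\<bar> / (2 * real n) \<le> ln c + (ln E + real s * ln (real n)) / (2 * real n)"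
    proof (rule eventually_sequentiallyI)
      fix n :: nat assume n: "n \<ge> 1"
      have "0 < c ^ (2 * n)" using c0 by simp
      with lower[OF n] have "0 < \<bar>D n\<bar>" by linarith
      then have "ln \<bar>D n\<bar> \<le> ln (E * real n ^ s * c ^ (2 * n))"
        using upper[OF n] by (intro ln_mono) auto
      also have "\<dots> = ln E + real s * ln (real n) + 2 * real n * ln c"
        using n c0 E0 by (simp add: ln_mult_pos ln_realpow)
      finally show "ln \<bar>D n\<bar> / (2 * real n) \<le> ln c + (ln E + real s * ln (real n)) / (2 * real n)"
        using n by (simp add: field_simps)
    qed
    show "(\<lambda>n. ln c) \<longlonglongrightarrow> ln c" by simp
    have "(\<lambda>n. (ln E + real s * ln (real n)) / (2 * real n)) \<longlonglongrightarrow> 0" by real_asymp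
    from tendsto_add[OF tendsto_const this] show "(\<lambda>n. ln c + (ln E + real s * ln (real n)) / (2 * real n)) \<longlonglongrightarrow> ln c"
      by simp
  qed
  moreover have "(1 / (2 * pi)) * (LBINT \<omega>=-pi..pi. ln (cmod (freq_resp g \<eta> \<omega>))) = ln c"
  proof -
    have fr: "freq_resp g \<eta> \<omega> = a * (\<Prod>z\<leftarrow>as. cis (-\<omega>) - z)" for \<omega>
    proof -
      have "cis (- \<omega>) ^ k = cis (- (real k * \<omega>))" for k
        using Complex.DeMoivre[of "- \<omega>" k] by simp
      then have "freq_resp g \<eta> \<omega> = poly p (cis (-\<omega>))"
        by (simp add: freq_resp_def p_def poly_sum poly_monom)
      also have "\<dots> = a * poly (\<Prod>z\<leftarrow>as. [:- z, 1:]) (cis (-\<omega>))" using as(1) by (metis poly_smult)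
      also have "poly (\<Prod>z\<leftarrow>as. [:- z, 1:]) (cis (-\<omega>)) = (\<Prod>z\<leftarrow>as. cis (-\<omega>) - z)"
        by (induction as) (auto simp: left_diff_distrib)
      finally show ?thesis .
    qed
    have "ln c = ln (cmod a) + (\<Sum>z\<leftarrow>as. ln (max 1 (cmod z)))"
    proof -
      \<comment> \<open>The constant coefficient of a reflected factor is 1 for |z| < 1 and -z
        otherwise, so its modulus is exactly the quantity max 1 |z| in Jensen's formula.\<close>
      have "cmod (coeff (\<Prod>z\<leftarrow>as. reflect_factor z) 0) = (\<Prod>z\<leftarrow>as. max 1 (cmod z))"
        by (induction as) (auto simp: coeff_mult_0 norm_mult reflect_factor_def max_def)
      then have "c = cmod a * (\<Prod>z\<leftarrow>as. max 1 (cmod z))"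
        by (simp add: c_def Q_def norm_mult)
      moreover have "0 < (\<Prod>z\<leftarrow>as. max 1 (cmod z)) \<and> ln (\<Prod>z\<leftarrow>as. max 1 (cmod z)) = (\<Sum>z\<leftarrow>as. ln (max 1 (cmod z)))"
        by (induction as) (auto simp: ln_mult_pos)
      ultimately show ?thesis using a0 by (simp add: ln_mult_pos)
    qed
    then show ?thesis using interval_integral_ln_cmod_prod[OF a0 fr] by simp
  qed
  moreover have "\<forall>\<^sub>F n in sequentially. ln \<bar>D n\<bar> / (2 * real n) =
      (eff_entropy M (n + \<eta>) n (conv_mat g \<eta>)
        (\<lambda>\<omega>. mat_vec (n + \<eta>) n (conv_mat g \<eta>) (proc_vec n u \<omega>)) - diff_entropy M n (proc_vec n u)) / real n"
    using ratio by (intro eventually_sequentiallyI[of 1]) simp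
  ultimately show ?thesis using Lim_transform_eventually by fastforce
qed

end
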